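(* Let $f:\mathbb{R}^d\to\mathbb{R}$ be Lipschitz continuous with constant $L_0>0$, i.e. $|f(z_1)-f(z_2)|\le L_0\|z_1-z_2\|$ for all $z_1,z_2\in\mathbb{R}^d$ ($f$ need not be differentiable). Let $\mu>0$, let $L_1(f_\mu)>0$ be the Lipschitz constant of the gradient of $f_\mu$, i.e. $\|\nabla f_\mu(z_1)-\nabla f_\mu(z_2)\|_*\le L_1(f_\mu)\|z_1-z_2\|$ for all $z_1,z_2$, and let $\sigma\ge 0$ satisfy $E_u[\|G_\mu(z;u)-F_\mu(z)\|_*^2]\le\sigma^2$ for all $z\in\mathbb{R}^d$. Suppose that for some $\rho\in[0,\frac{1}{4L_1(f_\mu)\kappa^2})$ there is $z^*\in\mathbb{R}^d$ such that $$\langle F_\mu(z),z-z^*\rangle+\frac{\rho}{2}\|F_\mu(z)\|_*^2\ge0\quad\text{for all }z\in\mathbb{R}^d.$$ Let $\{z_k\}_{k\ge0}$, $\{\hat z_k\}_{k\ge0}$ be generated by the variance-reduced zeroth-order extragradient algorithm (unconstrained) with sample sizes $t_k\in\mathbb{N}$, $t_k\ge1$, and constant step sizes $h_1,h_2>0$ satisfying $h_1\le\frac{1}{L_1(f_\mu)\overline{\lambda}\kappa}$ and $h_2\in\left(\sqrt{\frac{\rho}{L_1(f_\mu)\overline{\lambda}\underline{\lambda}\kappa}},\frac{h_1}{2}\right]$. Then for every number of iterations $N\ge0$, $$\frac{1}{N+1}\sum_{k=0}^{N}E_{\mathcal{U}_k}[|F_\mu(\hat z_k)|^2]\le\frac{2L_1(f_\mu)\overline{\lambda}\underline{\lambda}\kappa|z_0-z^*|^2}{(L_1(f_\mu)\overline{\lambda}\underline{\lambda}\kappa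 h_2^2-\rho)(N+1)}+\frac{3\underline{\lambda}\sigma^2}{L_1(f_\mu)\kappa(L_1(f_\mu)\overline{\lambda}\underline{\lambda}\kappa h_2^2-\rho)}\cdot\frac{1}{N+1}\sum_{k=0}^{N}\frac{1}{t_k}.$$
   Context: $n,m\in\mathbb{N}$, $d=n+m$, points $z=(x,y)\in\mathbb{R}^n\times\mathbb{R}^m=\mathbb{R}^d$. $B_1\in\mathbb{R}^{n\times n}$, $B_2\in\mathbb{R}^{m\times m}$ are symmetric positive definite, $B$ is the block-diagonal matrix with blocks $B_1,B_2$; $\underline{\lambda}$, $\overline{\lambda}$ are its smallest and largest eigenvalues and $\kappa=\overline{\lambda}/\underline{\lambda}$. $\langle\cdot,\cdot\rangle$ is the Euclidean inner product, $|z|=\langle z,z\rangle^{1/2}$ (absolute value for scalars), $\|z\|=\langle z,Bz\rangle^{1/2}$, $\|z\|_*=\langle z,B^{-1}z\rangle^{1/2}$. For $\mu>0$ the Gaussian smoothing of $f$ is $f_\mu(z)=E_u[f(z+\mu u)]$ with $u\sim\mathcal{N}(0,B^{-1})$ (it is continuously differentiable, and for Lipschitz $f$ its gradient is Lipschitz), and $F_\mu(z)=(\nabla_x f_\mu(z),-\nabla_y f_\mu(z))$. For $u=(u_1,u_2)\in\mathbb{R}^n\times\mathbb{R}^m$ the random oracle is $G_\mu(z;u)=\frac{f(z+\mu u)-f(z)}{\mu}\,(B_1u_1,-B_2u_2)$. Variance-reduced ZO-EG (unconstrained): given $z_0\in\mathbb{R}^d$, for $k=0,1,\dots,N$: sample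 $\hat u_k^1,\dots,\hat u_k^{t_k}\sim\mathcal{N}(0,B^{-1})$ and set $\hat z_k=z_k-h_1\frac{1}{t_k}\sum_{i=1}^{t_k}G_\mu(z_k;\hat u_k^i)$; sample $u_k^1,\dots,u_k^{t_k}\sim\mathcal{N}(0,B^{-1})$ and set $z_{k+1}=z_k-h_2\frac{1}{t_k}\sum_{i=1}^{t_k}G_\mu(\hat z_k;u_k^i)$. All sampled vectors are independent. $\mathcal{U}_k=[(u_0,\hat u_0),\dots,(u_k,\hat u_k)]$, where $u_j,\hat u_j$ denote the batches sampled at iteration $j$, and $E_{\mathcal{U}_k}$ is expectation over $\mathcal{U}_k$. *)

theory Defs
  imports "HOL-Probability.Probability"
begin

text \<open>
  Points of \<open>\<real>\<^sup>n \<times> \<real>\<^sup>m\<close> have type \<open>(real ^ 'n) \<times> (real ^ 'm)\<close>; the inner product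
  and norm of the product type are the Euclidean ones.
\<close>

definition spd :: "real ^ 'n ^ 'n \<Rightarrow> bool" where
  "spd A \<longleftrightarrow> transpose A = A \<and> (\<forall>x. x \<noteq> 0 \<longrightarrow> x \<bullet> (A *v x) > 0)"

text \<open>The action of the block-diagonal matrix with blocks \<open>A\<close> and \<open>C\<close>.\<close>

definition block_diag ::
    "real ^ 'n ^ 'n \<Rightarrow> real ^ 'm ^ 'm \<Rightarrow> (real ^ 'n) \<times> (real ^ 'm) \<Rightarrow> (real ^ 'n) \<times> (real ^ 'm)" where
  "block_diag A C z = (A *v fst z, C *v snd z)"

definition eigenvalues :: "('a::real_vector \<Rightarrow> 'a) \<Rightarrow> real set" where
  "eigenvalues T = {l. \<exists>v. v \<noteq> 0 \<and> T v = l *\<^sub>R v}"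

definition lam_min :: "real ^ 'n ^ 'n \<Rightarrow> real ^ 'm ^ 'm \<Rightarrow> real" where
  "lam_min B1 B2 = Min (eigenvalues (block_diag B1 B2))"

definition lam_max :: "real ^ 'n ^ 'n \<Rightarrow> real ^ 'm ^ 'm \<Rightarrow> real" where
  "lam_max B1 B2 = Max (eigenvalues (block_diag B1 B2))"

definition cond_num :: "real ^ 'n ^ 'n \<Rightarrow> real ^ 'm ^ 'm \<Rightarrow> real" where
  "cond_num B1 B2 = lam_max B1 B2 / lam_min B1 B2"

definition Bnorm ::
    "real ^ 'n ^ 'n \<Rightarrow> real ^ 'm ^ 'm \<Rightarrow> (real ^ 'n) \<times> (real ^ 'm) \<Rightarrow> real" where
  "Bnorm B1 B2 z = sqrt (z \<bullet> block_diag B1 B2 z)"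

definition Bnorm_dual ::
    "real ^ 'n ^ 'n \<Rightarrow> real ^ 'm ^ 'm \<Rightarrow> (real ^ 'n) \<times> (real ^ 'm) \<Rightarrow> real" where
  "Bnorm_dual B1 B2 z = sqrt (z \<bullet> block_diag (matrix_inv B1) (matrix_inv B2) z)"

text \<open>
  The centred normal distribution on \<open>\<real>\<^sup>n \<times> \<real>\<^sup>m\<close> whose covariance matrix is
  block-diagonal with (positive definite) blocks \<open>S1\<close> and \<open>S2\<close>; the determinant of that
  covariance matrix is \<open>det S1 * det S2\<close>.
\<close>

definition normal_block ::
    "real ^ 'n ^ 'n \<Rightarrow> real ^ 'm ^ 'm \<Rightarrow> ((real ^ 'n) \<times> (real ^ 'm)) measure" where
  "normal_block S1 S2 = density lborel (\<lambda>u. ennreal (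
     exp (- (u \<bullet> block_diag (matrix_inv S1) (matrix_inv S2) u) / 2)
       / sqrt ((2 * pi) ^ (CARD('n) + CARD('m)) * (det S1 * det S2))))"

text \<open>The distribution \<open>N(0, B\<^sup>-\<^sup>1)\<close>.\<close>

definition gauss ::
    "real ^ 'n ^ 'n \<Rightarrow> real ^ 'm ^ 'm \<Rightarrow> ((real ^ 'n) \<times> (real ^ 'm)) measure" where
  "gauss B1 B2 = normal_block (matrix_inv B1) (matrix_inv B2)"

text \<open>The gradient with respect to the Euclidean inner product.\<close>

definition grad :: "('a::real_inner \<Rightarrow> real) \<Rightarrow> 'a \<Rightarrow> 'a" where
  "grad g x = (THE D. GDERIV g x :> D)"

definition smooth ::
    "real ^ 'n ^ 'n \<Rightarrow> real ^ 'm ^ 'm \<Rightarrow> real \<Rightarrow> ((real ^ 'n) \<times> (real ^ 'm) \<Rightarrow> real)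
      \<Rightarrow> (real ^ 'n) \<times> (real ^ 'm) \<Rightarrow> real" where
  "smooth B1 B2 \<mu> f z = (\<integral>u. f (z + \<mu> *\<^sub>R u) \<partial>gauss B1 B2)"

definition F_smooth ::
    "real ^ 'n ^ 'n \<Rightarrow> real ^ 'm ^ 'm \<Rightarrow> real \<Rightarrow> ((real ^ 'n) \<times> (real ^ 'm) \<Rightarrow> real)
      \<Rightarrow> (real ^ 'n) \<times> (real ^ 'm) \<Rightarrow> (real ^ 'n) \<times> (real ^ 'm)" where
  "F_smooth B1 B2 \<mu> f z =
     (grad (\<lambda>x. smooth B1 B2 \<mu> f (x, snd z)) (fst z),
      - grad (\<lambda>y. smooth B1 B2 \<mu> f (fst z, y)) (snd z))"

definition G_oracle ::
    "real ^ 'n ^ 'n \<Rightarrow> real ^ 'm ^ 'm \<Rightarrow> real \<Rightarrow> ((real ^ 'n) \<times> (real ^ 'm) \<Rightarrow> real)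
      \<Rightarrow> (real ^ 'n) \<times> (real ^ 'm) \<Rightarrow> (real ^ 'n) \<times> (real ^ 'm) \<Rightarrow> (real ^ 'n) \<times> (real ^ 'm)" where
  "G_oracle B1 B2 \<mu> f z u =
     ((f (z + \<mu> *\<^sub>R u) - f z) / \<mu>) *\<^sub>R (B1 *v fst u, - (B2 *v snd u))"

text \<open>
  All sample vectors \<open>u\<^sub>k\<^sup>i\<close>, \<open>uh\<^sub>k\<^sup>i\<close> (\<open>k \<ge> 0\<close>, \<open>1 \<le> i \<le> t\<^sub>k\<close>) have law \<open>N(0, B\<^sup>-\<^sup>1)\<close> and
  are jointly independent. The Boolean index tells the two families apart.
\<close>

definition gauss_samples ::
    "real ^ 'n ^ 'n \<Rightarrow> real ^ 'm ^ 'm \<Rightarrow> (nat \<Rightarrow> nat) \<Rightarrow> 'w measure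
      \<Rightarrow> (nat \<Rightarrow> nat \<Rightarrow> 'w \<Rightarrow> (real ^ 'n) \<times> (real ^ 'm))
      \<Rightarrow> (nat \<Rightarrow> nat \<Rightarrow> 'w \<Rightarrow> (real ^ 'n) \<times> (real ^ 'm)) \<Rightarrow> bool" where
  "gauss_samples B1 B2 t M uh u \<longleftrightarrow>
     (\<forall>k. \<forall>i\<in>{1..t k}. distr M borel (uh k i) = gauss B1 B2 \<and> distr M borel (u k i) = gauss B1 B2) \<and>
     prob_space.indep_vars M (\<lambda>_. borel) (\<lambda>(b, k, i). if b then u k i else uh k i)
       (UNIV \<times> (SIGMA k:UNIV. {1..t k}))"

text \<open>
  Pathwise recursion of the variance-reduced zeroth-order extragradient method without
  constraints, started at the deterministic point \<open>z0\<close>.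
\<close>

definition zo_eg_run ::
    "real ^ 'n ^ 'n \<Rightarrow> real ^ 'm ^ 'm \<Rightarrow> real \<Rightarrow> ((real ^ 'n) \<times> (real ^ 'm) \<Rightarrow> real)
      \<Rightarrow> real \<Rightarrow> real \<Rightarrow> (nat \<Rightarrow> nat) \<Rightarrow> (real ^ 'n) \<times> (real ^ 'm) \<Rightarrow> 'w measure
      \<Rightarrow> (nat \<Rightarrow> nat \<Rightarrow> 'w \<Rightarrow> (real ^ 'n) \<times> (real ^ 'm))
      \<Rightarrow> (nat \<Rightarrow> nat \<Rightarrow> 'w \<Rightarrow> (real ^ 'n) \<times> (real ^ 'm))
      \<Rightarrow> (nat \<Rightarrow> 'w \<Rightarrow> (real ^ 'n) \<times> (real ^ 'm))
      \<Rightarrow> (nat \<Rightarrow> 'w \<Rightarrow> (real ^ 'n) \<times> (real ^ 'm)) \<Rightarrow> bool" where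
  "zo_eg_run B1 B2 \<mu> f h1 h2 t z0 M uh u zh z \<longleftrightarrow>
     (\<forall>w\<in>space M. z 0 w = z0 \<and>
       (\<forall>k. zh k w = z k w - h1 *\<^sub>R ((1 / real (t k)) *\<^sub>R
                (\<Sum>i=1..t k. G_oracle B1 B2 \<mu> f (z k w) (uh k i w))) \<and>
            z (Suc k) w = z k w - h2 *\<^sub>R ((1 / real (t k)) *\<^sub>R
                (\<Sum>i=1..t k. G_oracle B1 B2 \<mu> f (zh k w) (u k i w)))))"

end

theory Submission
  imports Defs
begin

text \<open>
  Everything is carried out in the Euclidean norm: \<open>F\<close> is Lipschitz with constant \<open>L1 * lmax\<close>, the
  oracle variance is at most \<open>lmax * \<sigma>\<^sup>2\<close>, and the weak Minty inequality holds with the term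
  \<open>\<rho> / (2 * lmin) * (norm (F v))\<^sup>2\<close>.

  The oracle is unbiased. Translating the Gaussian density writes
  \<open>f\<^sub>\<mu> (z + \<mu> *\<^sub>R s)\<close> as the expectation of \<open>f (z + \<mu> *\<^sub>R u)\<close> times the weight
  \<open>exp (u \<bullet> B s - (s \<bullet> B s) / 2)\<close>, which is \<open>1 + u \<bullet> B s\<close> up to a quadratic remainder with
  integrable coefficient; hence \<open>f\<^sub>\<mu>\<close> is differentiable although \<open>f\<close> need not be.

  One extragradient step decreases the squared distance to \<open>zstar\<close> by
  \<open>(h1 * h2 - h2\<^sup>2 - h2 * \<rho> / lmin) * (norm (F (zh k)))\<^sup>2\<close>, up to centred terms and multiples of the
  squared batch noise, whose mean is at most \<open>lmax * \<sigma>\<^sup>2 / t k\<close> by independence. Summing over the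
  iterations gives the bound, with a factor of two to spare in the leading coefficient.
\<close>

section \<open>Rayleigh quotients and the norms of a block-diagonal matrix\<close>

text \<open>The quadratic polynomial \<open>s \<mapsto> (x + s *\<^sub>R y) \<bullet> T (x + s
  *\<^sub>R y)\<close> is nonnegative. Its value at the minimiser \<open>- b / a\<close> gives the
  claim when \<open>a > 0\<close>; when \<open>a = 0\<close> it is affine in \<open>s\<close>, which
  forces \<open>b = 0\<close>.\<close>

lemma psd_Cauchy_Schwarz:
  fixes T :: "'a::real_inner \<Rightarrow> 'a"
  assumes lin: "linear T" and sym: "\<And>x y. T x \<bullet> y = x \<bullet> T y" and psd: "\<And>x. 0 \<le> x \<bullet> T x"
  shows "(x \<bullet> T y)\<^sup>2 \<le> (x \<bullet> T x) * (y \<bullet> T y)"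
proof -
  define a b c where "a = y \<bullet> T y" and "b = x \<bullet> T y" and "c = x \<bullet> T x"
  have yx: "y \<bullet> T x = b"
    using sym[of x y] by (simp add: b_def inner_commute)
  have q: "0 \<le> c + 2 * s * b + s\<^sup>2 * a" for s
    using psd[of "x + s *\<^sub>R y"] yx
    by (simp add: linear_add[OF lin] linear_scale[OF lin] inner_add_left inner_add_right
        a_def b_def c_def algebra_simps power2_eq_square)
  have "a \<ge> 0" using psd by (simp add: a_def)
  show ?thesis
  proof (cases "a = 0")
    case True
    have "b = 0"
    proof (rule ccontr)
      assume "b \<noteq> 0"
      \<comment> \<open>At this \<open>s\<close> the affine function \<open>c + 2 * s * b\<close>
        equals \<open>-1\<close>.\<close>
      then show False using q[of "- (c + 1) / (2 * b)"] True by (simp add: field_simps)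
    qed
    then show ?thesis using True by (simp add: a_def b_def)
  next
    case False
    with \<open>a \<ge> 0\<close> have "a > 0" by simp
    have "0 \<le> c - b\<^sup>2 / a"
      using q[of "- b / a"] \<open>a > 0\<close> by (simp add: field_simps power2_eq_square)
    then show ?thesis using \<open>a > 0\<close> by (simp add: field_simps a_def b_def c_def)
  qed
qed

text \<open>The Rayleigh quotient attains its minimum \<open>l\<close> on the compact unit sphere,
  at some \<open>v\<close>. Then \<open>S = T - l\<close> is positive semidefinite with
  \<open>v \<bullet> S v = 0\<close>, and Cauchy-Schwarz for the form of \<open>S\<close>, applied
  to \<open>S v\<close> and \<open>v\<close>, yields \<open>S v = 0\<close>.\<close>

lemma selfadjoint_least_eigenvalue:
  fixes T :: "'a::euclidean_space \<Rightarrow> 'a"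
  assumes lin: "linear T" and sym: "\<And>x y. T x \<bullet> y = x \<bullet> T y"
  obtains l where "l \<in> eigenvalues T" and "\<And>x. l * (norm x)\<^sup>2 \<le> x \<bullet> T x"
proof -
  have "compact (sphere (0::'a) 1)" "sphere (0::'a) 1 \<noteq> {}" by auto
  moreover have "continuous_on (sphere 0 1) (\<lambda>x. x \<bullet> T x)"
    by (intro continuous_intros linear_continuous_on linear_conv_bounded_linear[THEN iffD1] lin)
  ultimately obtain v where v: "norm v = 1" and min: "\<And>x. norm x = 1 \<Longrightarrow> v \<bullet> T v \<le> x \<bullet> T x"
    using continuous_attains_inf[of "sphere 0 1" "\<lambda>x. x \<bullet> T x"] by auto
  define l where "l = v \<bullet> T v"
  have bound: "l * (norm x)\<^sup>2 \<le> x \<bullet> T x" for x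
  proof (cases "x = 0")
    case False
    then have "l \<le> (x /\<^sub>R norm x) \<bullet> T (x /\<^sub>R norm x)"
      unfolding l_def by (intro min) simp
    also have "\<dots> = (x \<bullet> T x) / (norm x)\<^sup>2"
      by (simp add: linear_scale[OF lin] power2_eq_square divide_inverse)
    finally show ?thesis using False by (simp add: field_simps)
  qed (simp add: linear_0[OF lin])
  define S where "S x = T x - l *\<^sub>R x" for x
  have "linear S" unfolding S_def by (intro linear_compose_sub lin linear_scale_self)
  moreover have "S x \<bullet> y = x \<bullet> S y" for x y
    by (simp add: S_def sym inner_diff_left inner_diff_right)
  moreover have "0 \<le> x \<bullet> S x" for x
    using bound[of x] by (simp add: S_def inner_diff_right dot_square_norm)
  ultimately have "(S v \<bullet> S v)\<^sup>2 \<le> (S v \<bullet> S (S v)) * (v \<bullet> S v)"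
    by (rule psd_Cauchy_Schwarz)
  also have "v \<bullet> S v = 0"
    by (simp add: S_def inner_diff_right l_def[symmetric] dot_square_norm v)
  finally have "S v = 0" by simp
  moreover have "v \<noteq> 0" using v by auto
  ultimately have "l \<in> eigenvalues T" unfolding eigenvalues_def S_def by auto
  with bound show thesis using that by blast
qed

lemma selfadjoint_greatest_eigenvalue:
  fixes T :: "'a::euclidean_space \<Rightarrow> 'a"
  assumes lin: "linear T" and sym: "\<And>x y. T x \<bullet> y = x \<bullet> T y"
  obtains l where "l \<in> eigenvalues T" and "\<And>x. x \<bullet> T x \<le> l * (norm x)\<^sup>2"
proof -
  obtain l where l: "l \<in> eigenvalues (\<lambda>x. - T x)" "\<And>x. l * (norm x)\<^sup>2 \<le> x \<bullet> - T x"
    using selfadjoint_least_eigenvalue[of "\<lambda>x. - T x"] linear_compose_neg[OF lin] sym by auto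
  have "- l \<in> eigenvalues T"
    using l(1) unfolding eigenvalues_def
    by (auto simp: minus_equation_iff[of _ "l *\<^sub>R _"] eq_commute)
  moreover have "x \<bullet> T x \<le> - l * (norm x)\<^sup>2" for x
    using l(2)[of x] by simp
  ultimately show thesis using that by blast
qed

text \<open>Eigenvectors of distinct eigenvalues are orthogonal, hence linearly independent.
  Finiteness is what gives \<open>Min\<close> and \<open>Max\<close> in \<open>lam_min\<close> and
  \<open>lam_max\<close> their meaning.\<close>

lemma finite_eigenvalues_selfadjoint:
  fixes T :: "'a::euclidean_space \<Rightarrow> 'a"
  assumes sym: "\<And>x y. T x \<bullet> y = x \<bullet> T y"
  shows "finite (eigenvalues T)"
proof -
  define e where "e l = (SOME v. v \<noteq> 0 \<and> T v = l *\<^sub>R v)" for l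
  have e: "e l \<noteq> 0" "T (e l) = l *\<^sub>R e l" if "l \<in> eigenvalues T" for l
    using someI_ex[of "\<lambda>v. v \<noteq> 0 \<and> T v = l *\<^sub>R v"] that unfolding eigenvalues_def e_def by auto
  have inj: "inj_on e (eigenvalues T)"
  proof (rule inj_onI)
    fix l k assume "l \<in> eigenvalues T" "k \<in> eigenvalues T" and eq: "e l = e k"
    then have "l *\<^sub>R e l = k *\<^sub>R e l" using e(2) by metis
    then show "l = k" using e(1)[OF \<open>l \<in> eigenvalues T\<close>] by simp
  qed
  have "pairwise orthogonal (e ` eigenvalues T)"
  proof (rule pairwiseI, clarsimp)
    fix l k assume l: "l \<in> eigenvalues T" and k: "k \<in> eigenvalues T" and ne: "e l \<noteq> e k"
    have "l * (e l \<bullet> e k) = k * (e l \<bullet> e k)"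
      using sym[of "e l" "e k"] e(2)[OF l] e(2)[OF k] by simp
    moreover have "l \<noteq> k" using ne by auto
    ultimately show "orthogonal (e l) (e k)" by (simp add: orthogonal_def)
  qed
  moreover have "0 \<notin> e ` eigenvalues T" using e(1) by force
  ultimately have "finite (e ` eigenvalues T)"
    by (intro independent_imp_finite pairwise_orthogonal_independent)
  then show ?thesis using inj by (rule finite_imageD)
qed

section \<open>Symmetric positive definite matrices and their inverses\<close>

lemma spd_sym: "spd A \<Longrightarrow> (A *v x) \<bullet> y = x \<bullet> (A *v y)"
  using dot_lmul_matrix[of x A y] by (simp add: spd_def transpose_matrix_vector[symmetric])

lemma spd_nonneg: "spd A \<Longrightarrow> 0 \<le> x \<bullet> (A *v x)"
  by (cases "x = 0") (auto simp: spd_def less_imp_le)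

lemma spd_pos: "spd A \<Longrightarrow> x \<noteq> 0 \<Longrightarrow> 0 < x \<bullet> (A *v x)"
  by (simp add: spd_def)

lemma spd_invertible: "spd A \<Longrightarrow> invertible A"
  unfolding spd_def by (metis inner_zero_right less_irrefl matrix_left_invertible_ker
      invertible_def matrix_left_right_inverse)

lemma matrix_inv_inverse:
  fixes A :: "real ^ 'n ^ 'n"
  assumes "invertible A"
  shows "matrix_inv A ** A = mat 1" "A ** matrix_inv A = mat 1"
  using assms unfolding invertible_def matrix_inv_def by (metis (mono_tags, lifting) someI_ex)+

text \<open>The density of \<open>gauss\<close> inverts the covariance blocks, which are themselves
  inverses of \<open>B1\<close> and \<open>B2\<close>; this brings the exponent back to
  \<open>B1\<close> and \<open>B2\<close>.\<close>

lemma matrix_inv_matrix_inv: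
  fixes A :: "real ^ 'n ^ 'n"
  assumes "invertible A"
  shows "matrix_inv (matrix_inv A) = A"
proof -
  have i: "invertible (matrix_inv A)"
    using matrix_inv_inverse[OF assms] unfolding invertible_def by blast
  have "matrix_inv (matrix_inv A) = matrix_inv (matrix_inv A) ** (matrix_inv A ** A)"
    by (simp add: matrix_inv_inverse[OF assms])
  also have "\<dots> = A"
    by (simp add: matrix_mul_assoc matrix_inv_inverse[OF i])
  finally show ?thesis .
qed

lemma linear_block_diag: "linear (block_diag A C)"
  by (rule linearI) (simp_all add: block_diag_def matrix_vector_right_distrib matrix_vector_mult_scaleR)

lemma block_diag_measurable [measurable]: "block_diag A C \<in> borel_measurable borel"
  by (intro borel_measurable_continuous_onI linear_continuous_on
      linear_conv_bounded_linear[THEN iffD1] linear_block_diag)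

section \<open>Extreme eigenvalues of the block-diagonal matrix and comparison of its norms with the
  Euclidean norm\<close>

locale spd_pair =
  fixes B1 :: "real ^ 'n ^ 'n" and B2 :: "real ^ 'm ^ 'm"
  assumes spd1: "spd B1" and spd2: "spd B2"
begin

lemma block_diag_sym: "block_diag B1 B2 x \<bullet> y = x \<bullet> block_diag B1 B2 y"
  by (simp add: block_diag_def inner_prod_def spd_sym spd1 spd2)

lemma block_diag_pos: "x \<noteq> 0 \<Longrightarrow> 0 < x \<bullet> block_diag B1 B2 x"
  using spd_pos[OF spd1, of "fst x"] spd_pos[OF spd2, of "snd x"]
    spd_nonneg[OF spd1, of "fst x"] spd_nonneg[OF spd2, of "snd x"]
  by (cases "fst x = 0") (auto simp: block_diag_def inner_prod_def prod_eq_iff intro: add_pos_nonneg)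

lemma finite_eigenvalues: "finite (eigenvalues (block_diag B1 B2))"
  by (rule finite_eigenvalues_selfadjoint) (rule block_diag_sym)

text \<open>The minimum of the Rayleigh quotient is an eigenvalue, so \<open>lam_min\<close> lies
  below it and inherits the lower bound. Positivity comes from an eigenvector of
  \<open>lam_min\<close> itself.\<close>

lemma lam_min_pos: "0 < lam_min B1 B2"
  and lam_min_le: "lam_min B1 B2 * (norm x)\<^sup>2 \<le> x \<bullet> block_diag B1 B2 x"
proof -
  let ?E = "eigenvalues (block_diag B1 B2)"
  obtain l where l: "l \<in> ?E" "\<And>x. l * (norm x)\<^sup>2 \<le> x \<bullet> block_diag B1 B2 x"
    using selfadjoint_least_eigenvalue linear_block_diag block_diag_sym by metis
  have "lam_min B1 B2 \<in> ?E"
    unfolding lam_min_def using finite_eigenvalues l(1) by (intro Min_in) auto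
  then obtain v where "v \<noteq> 0" "block_diag B1 B2 v = lam_min B1 B2 *\<^sub>R v"
    unfolding eigenvalues_def by auto
  then show "0 < lam_min B1 B2"
    using block_diag_pos[of v] by (metis inner_gt_zero_iff inner_scaleR_right zero_less_mult_pos2)
  have "lam_min B1 B2 \<le> l"
    unfolding lam_min_def using finite_eigenvalues l(1) by (rule Min_le)
  then show "lam_min B1 B2 * (norm x)\<^sup>2 \<le> x \<bullet> block_diag B1 B2 x"
    using l(2)[of x] by (meson mult_right_mono order_trans zero_le_power2)
qed

lemma lam_max_ge: "x \<bullet> block_diag B1 B2 x \<le> lam_max B1 B2 * (norm x)\<^sup>2"
proof -
  let ?E = "eigenvalues (block_diag B1 B2)"
  obtain l where l: "l \<in> ?E" "\<And>x. x \<bullet> block_diag B1 B2 x \<le> l * (norm x)\<^sup>2"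
    using selfadjoint_greatest_eigenvalue linear_block_diag block_diag_sym by metis
  have "l \<le> lam_max B1 B2"
    unfolding lam_max_def using finite_eigenvalues l(1) by (rule Max_ge)
  then show ?thesis
    using l(2)[of x] by (meson mult_right_mono order_trans zero_le_power2)
qed

lemma lam_min_le_lam_max: "lam_min B1 B2 \<le> lam_max B1 B2"
proof -
  obtain v :: "(real ^ 'n) \<times> (real ^ 'm)" where "norm v = 1"
    by (meson vector_choose_size zero_le_one)
  then show ?thesis using lam_min_le[of v] lam_max_ge[of v] by simp
qed

lemma lam_max_pos: "0 < lam_max B1 B2"
  using lam_min_pos lam_min_le_lam_max by linarith

lemma Bnorm_sq: "(Bnorm B1 B2 x)\<^sup>2 = x \<bullet> block_diag B1 B2 x"
  using block_diag_pos[of x] by (cases "x = 0") (auto simp: Bnorm_def)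

lemma Bnorm_le: "Bnorm B1 B2 x \<le> sqrt (lam_max B1 B2) * norm x"
  by (rule power2_le_imp_le)
     (use lam_max_ge[of x] lam_max_pos in \<open>auto simp: Bnorm_sq power_mult_distrib\<close>)

lemma block_diag_inverse:
  "block_diag B1 B2 (block_diag (matrix_inv B1) (matrix_inv B2) x) = x"
  using matrix_inv_inverse[OF spd_invertible[OF spd1]] matrix_inv_inverse[OF spd_invertible[OF spd2]]
  by (simp add: block_diag_def matrix_vector_mul_assoc)

text \<open>With \<open>y\<close> the image of \<open>x\<close> under the inverse, no spectral
  information on the inverse is required. The lower bound is Cauchy-Schwarz for the form of the
  block matrix at \<open>x\<close> and \<open>y\<close>; the upper one combines its coercivity at
  \<open>y\<close> with \<open>y \<bullet> x \<le> norm y * norm x\<close>.\<close>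

lemma Bnorm_dual_sq_bounds:
  "(Bnorm_dual B1 B2 x)\<^sup>2 = x \<bullet> block_diag (matrix_inv B1) (matrix_inv B2) x" (is ?eq)
  "(norm x)\<^sup>2 \<le> lam_max B1 B2 * (Bnorm_dual B1 B2 x)\<^sup>2" (is ?lower)
  "lam_min B1 B2 * (Bnorm_dual B1 B2 x)\<^sup>2 \<le> (norm x)\<^sup>2" (is ?upper)
proof -
  define y where "y = block_diag (matrix_inv B1) (matrix_inv B2) x"
  have By: "block_diag B1 B2 y = x" unfolding y_def by (rule block_diag_inverse)
  have nonneg: "0 \<le> v \<bullet> block_diag B1 B2 v" for v
    using lam_min_le[of v] lam_min_pos by (smt (verit) mult_nonneg_nonneg zero_le_power2)
  have pos: "0 \<le> x \<bullet> y" using nonneg[of y] By by (simp add: inner_commute)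
  show eq: ?eq using pos by (simp add: Bnorm_dual_def y_def)
  have "(x \<bullet> x)\<^sup>2 \<le> (x \<bullet> block_diag B1 B2 x) * (x \<bullet> y)"
    using psd_Cauchy_Schwarz[OF linear_block_diag block_diag_sym nonneg, of x y]
    by (simp add: By inner_commute)
  also have "\<dots> \<le> lam_max B1 B2 * (norm x)\<^sup>2 * (x \<bullet> y)"
    by (intro mult_right_mono lam_max_ge pos)
  finally have *: "(norm x)\<^sup>2 * (norm x)\<^sup>2 \<le> (norm x)\<^sup>2 * (lam_max B1 B2 * (x \<bullet> y))"
    by (simp add: dot_square_norm power2_eq_square mult_ac)
  show ?lower
  proof (cases "x = 0")
    case False
    then have "0 < (norm x)\<^sup>2" by simp
    with * have "(norm x)\<^sup>2 \<le> lam_max B1 B2 * (x \<bullet> y)" by (simp only: mult_le_cancel_left_pos)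
    then show ?thesis by (simp add: eq y_def)
  qed (use lam_max_pos in simp)
  have "lam_min B1 B2 * (norm y)\<^sup>2 \<le> norm y * norm x"
    using lam_min_le[of y] norm_cauchy_schwarz[of y x] By by simp
  then have "lam_min B1 B2 * norm y \<le> norm x"
    by (cases "y = 0") (auto simp: power2_eq_square mult_ac)
  then have "lam_min B1 B2 * norm y * norm x \<le> (norm x)\<^sup>2"
    by (simp add: power2_eq_square mult_right_mono)
  moreover have "lam_min B1 B2 * (x \<bullet> y) \<le> lam_min B1 B2 * (norm x * norm y)"
    using lam_min_pos norm_cauchy_schwarz[of x y] by (intro mult_left_mono) auto
  ultimately show ?upper unfolding eq y_def[symmetric] by (simp add: mult_ac)
qed

lemma norm_le_Bnorm_dual: "norm x \<le> sqrt (lam_max B1 B2) * Bnorm_dual B1 B2 x"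
proof (rule power2_le_imp_le)
  show "0 \<le> sqrt (lam_max B1 B2) * Bnorm_dual B1 B2 x"
    using lam_max_pos Bnorm_dual_sq_bounds(1)[of x]
    by (auto simp: Bnorm_dual_def intro!: mult_nonneg_nonneg)
qed (use Bnorm_dual_sq_bounds(2)[of x] lam_max_pos in \<open>simp_all add: power_mult_distrib\<close>)

end

section \<open>Gaussian smoothing\<close>

text \<open>The integrand is a product over the coordinates, so the integral is a finite product of
  one-dimensional Gaussian integrals.\<close>

lemma integrable_exp_neg_norm_sq:
  fixes a :: real
  assumes "a > 0"
  shows "integrable lborel (\<lambda>u::'a::euclidean_space. exp (- a * (norm u)\<^sup>2))"
proof -
  \<comment> \<open>The standard deviation for which \<open>1 / (2 * s\<^sup>2) = a\<close>.\<close>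
  define s where "s = sqrt (1 / (2 * a))"
  have s: "s > 0" "2 * s\<^sup>2 = 1 / a" using assms by (auto simp: s_def)
  have "integrable lborel (\<lambda>x. sqrt (2 * pi * s\<^sup>2) * normal_density 0 s x)"
    using s by (intro integrable_mult_right integrable_normal_density)
  also have "(\<lambda>x. sqrt (2 * pi * s\<^sup>2) * normal_density 0 s x) = (\<lambda>x. exp (- a * x\<^sup>2))"
    using s assms by (auto simp: normal_density_def fun_eq_iff)
  finally have 1: "integrable lborel (\<lambda>x::real. exp (- a * x\<^sup>2))" .
  have "(\<integral>\<^sup>+u. ennreal (exp (- a * (norm u)\<^sup>2)) \<partial>(lborel :: 'a measure))
      = (\<integral>\<^sup>+u. (\<Prod>b\<in>Basis. ennreal (exp (- a * (u \<bullet> b)\<^sup>2))) \<partial>(lborel :: 'a measure))"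
    by (simp add: prod_ennreal exp_sum[symmetric] sum_distrib_left[symmetric] sum_negf
        norm_eq_sqrt_inner euclidean_inner[of x x for x] power2_eq_square[symmetric] sum_nonneg)
  also have "\<dots> = (\<Prod>b\<in>(Basis :: 'a set). \<integral>\<^sup>+x. ennreal (exp (- a * x\<^sup>2)) \<partial>lborel)"
    by (intro nn_integral_lborel_prod) auto
  also have "\<dots> < \<infinity>"
    using 1 by (auto simp: integrable_iff_bounded ennreal_prod_eq_top less_top[symmetric] power_eq_top_ennreal)
  finally show ?thesis by (intro integrableI_nonneg) auto
qed

text \<open>Second-order Taylor expansion with Lagrange remainder, whose intermediate point is at
  most \<open>\<bar>x\<bar>\<close> in absolute value.\<close>

lemma abs_exp_minus_one_minus_le: "\<bar>exp x - 1 - x\<bar> \<le> x\<^sup>2 * exp \<bar>x\<bar>" for x :: real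
proof -
  obtain t where t: "\<bar>t\<bar> \<le> \<bar>x\<bar>" "exp x = (\<Sum>m<2. x ^ m / fact m) + exp t / fact 2 * x ^ 2"
    using Maclaurin_exp_le by blast
  have "\<bar>exp x - 1 - x\<bar> = exp t / 2 * x\<^sup>2"
    unfolding t(2) by (simp add: numeral_2_eq_2)
  also have "\<dots> \<le> exp \<bar>x\<bar> * x\<^sup>2"
  proof (rule mult_right_mono)
    have "exp t \<le> exp \<bar>x\<bar>" using t(1) by simp
    then show "exp t / 2 \<le> exp \<bar>x\<bar>" using exp_ge_zero[of t] by linarith
  qed simp
  finally show ?thesis by (simp add: mult.commute)
qed

lemma grad_eqI:
  assumes "GDERIV g x :> D"
  shows "grad g x = D"
  unfolding grad_def
proof (rule the_equality)
  fix D' assume "GDERIV g x :> D'"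
  then have "(\<lambda>h. h \<bullet> D') = (\<lambda>h. h \<bullet> D)"
    using assms unfolding gderiv_def by (rule has_derivative_unique)
  then show "D' = D" by (metis vector_eq_ldot)
qed (rule assms)

text \<open>The normalisation enters as the assumption that \<open>\<gamma>\<close> has mass one, so
  no Gaussian integral has to be evaluated and \<open>c\<close> may stay abstract.\<close>

locale gaussian_density =
  fixes T :: "'a::euclidean_space \<Rightarrow> 'a" and l c :: real and \<gamma> :: "'a measure"
  defines "\<gamma> \<equiv> density lborel (\<lambda>u. ennreal (c * exp (- (u \<bullet> T u) / 2)))"
  assumes lin: "linear T" and sym: "\<And>x y. T x \<bullet> y = x \<bullet> T y"
    and l_pos: "0 < l" and coercive: "\<And>x. l * (norm x)\<^sup>2 \<le> x \<bullet> T x"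
    and prob: "prob_space \<gamma>"
begin

sublocale prob_space \<gamma> by (rule prob)

text \<open>For negative \<open>c\<close> the conversion by \<open>ennreal\<close> would truncate
  the density to zero, contradicting mass one.\<close>

lemma c_nonneg: "0 \<le> c"
proof (rule ccontr)
  assume "\<not> 0 \<le> c"
  then have "\<gamma> = density lborel (\<lambda>_. 0)"
    unfolding \<gamma>_def by (intro arg_cong[where f="density lborel"] ext ennreal_neg)
      (simp add: mult_nonpos_nonneg)
  then have "emeasure \<gamma> (space \<gamma>) = 0" by (simp add: emeasure_density)
  then show False using emeasure_space_1 by simp
qed

lemma sets_gamma [simp, measurable_cong]: "sets \<gamma> = sets borel"
  by (simp add: \<gamma>_def)

lemma T_measurable [measurable]: "T \<in> borel_measurable borel"
  using lin by (intro borel_measurable_continuous_onI linear_continuous_on linear_conv_bounded_linear[THEN iffD1])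

text \<open>Completing the square absorbs \<open>a * norm u\<close> into half of the coercive term;
  a Gaussian with exponent \<open>- (l / 4) * (norm u)\<^sup>2\<close> remains as majorant.\<close>

lemma integrable_exp_norm: "integrable \<gamma> (\<lambda>u. exp (a * norm u))"
proof -
  have "integrable lborel (\<lambda>u::'a. c * exp (a\<^sup>2 / l) * exp (- (l / 4) * (norm u)\<^sup>2))"
    using l_pos by (intro integrable_mult_right integrable_exp_neg_norm_sq) auto
  then have "integrable lborel (\<lambda>u. (c * exp (- (u \<bullet> T u) / 2)) *\<^sub>R exp (a * norm u))"
  proof (rule Bochner_Integration.integrable_bound, goal_cases)
    case 2
    have "- (u \<bullet> T u) / 2 + a * norm u \<le> a\<^sup>2 / l + (- (l / 4) * (norm u)\<^sup>2)" for u
    proof -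
      have "0 \<le> l * (a / l - norm u / 2)\<^sup>2" using l_pos by simp
      also have "\<dots> = a\<^sup>2 / l - a * norm u + l / 4 * (norm u)\<^sup>2"
        using l_pos by (simp add: field_simps power2_eq_square)
      finally show ?thesis using coercive[of u] by simp
    qed
    then show ?case using c_nonneg
      by (auto simp: exp_add[symmetric] abs_mult mult.assoc intro!: mult_left_mono)
  qed measurable
  then show ?thesis
    unfolding \<gamma>_def using c_nonneg by (subst integrable_density) auto
qed

text \<open>The common criterion for integrability below: all integrands there grow at most
  exponentially in \<open>norm u\<close>.\<close>

lemma integrable_exp_bounded:
  fixes g :: "'a \<Rightarrow> 'b::{banach, second_countable_topology}"
  assumes "g \<in> borel_measurable borel" and "\<And>u. norm (g u) \<le> K * exp (a * norm u)"
  shows "integrable \<gamma> g"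
  by (rule Bochner_Integration.integrable_bound[OF integrable_mult_right[OF integrable_exp_norm, of K a]])
     (use assms in \<open>auto intro: order_trans[OF _ abs_ge_self]\<close>)

text \<open>The Cameron-Martin formula. Lebesgue measure is translation invariant, and the quotient
  of the shifted density by the original one is the exponential weight, because \<open>T\<close> is
  self-adjoint.\<close>

lemma integral_translate:
  fixes g :: "'a \<Rightarrow> real"
  assumes [measurable]: "g \<in> borel_measurable borel"
  shows "(\<integral>u. g (u + s) \<partial>\<gamma>) = (\<integral>u. g u * exp (u \<bullet> T s - (s \<bullet> T s) / 2) \<partial>\<gamma>)"
proof -
  have [measurable]: "(\<lambda>u. c * exp (- (u \<bullet> T u) / 2)) \<in> borel_measurable borel" by measurable
  let ?q = "\<lambda>u. c * exp (- (u \<bullet> T u) / 2)"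
  have q: "?q (u - s) = ?q u * exp (u \<bullet> T s - (s \<bullet> T s) / 2)" for u
  proof -
    have "(u - s) \<bullet> T (u - s) = u \<bullet> T u - 2 * (u \<bullet> T s) + s \<bullet> T s"
      using sym[of u s] by (simp add: linear_diff[OF lin] inner_diff_left inner_diff_right inner_commute)
    then have "- ((u - s) \<bullet> T (u - s)) / 2 = - (u \<bullet> T u) / 2 + (u \<bullet> T s - (s \<bullet> T s) / 2)"
      by (simp add: field_simps)
    then show ?thesis by (simp only: exp_add mult.assoc)
  qed
  have "(\<integral>u. g (u + s) \<partial>\<gamma>) = (\<integral>u. ?q u * g (u + s) \<partial>lborel)"
    unfolding \<gamma>_def using c_nonneg by (subst integral_density) auto
  also have "\<dots> = (\<integral>u. ?q (u - s) * g u \<partial>distr lborel borel ((+) s))"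
    by (subst integral_distr) (auto simp: add.commute)
  also have "distr lborel borel ((+) s) = lborel" by (rule lborel_distr_plus)
  also have "(\<integral>u. ?q (u - s) * g u \<partial>lborel) = (\<integral>u. ?q u * (g u * exp (u \<bullet> T s - (s \<bullet> T s) / 2)) \<partial>lborel)"
    by (simp only: q mult_ac)
  also have "\<dots> = (\<integral>u. g u * exp (u \<bullet> T s - (s \<bullet> T s) / 2) \<partial>\<gamma>)"
    unfolding \<gamma>_def using c_nonneg by (subst integral_density) auto
  finally show ?thesis .
qed

text \<open>With \<open>x\<close> the exponent, \<open>\<bar>x\<bar>\<close> is at most
  \<open>k * norm s * (norm u + 1)\<close>, so \<open>exp x - 1 - x\<close> is of second order in
  \<open>s\<close>; the part \<open>(s \<bullet> T s) / 2\<close> of \<open>x\<close> is of second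
  order as well and joins the remainder. One pair of constants serves all three estimates.\<close>

lemma exp_weight_expansion:
  obtains C b where "0 \<le> C" "0 \<le> b"
    "\<And>u. norm (T u) \<le> C * exp (b * norm u)"
    "\<And>u s. norm s \<le> 1 \<Longrightarrow>
      \<bar>exp (u \<bullet> T s - (s \<bullet> T s) / 2) - 1 - u \<bullet> T s\<bar> \<le> C * exp (b * norm u) * (norm s)\<^sup>2"
    "\<And>u s. norm s \<le> 1 \<Longrightarrow> exp (u \<bullet> T s - (s \<bullet> T s) / 2) \<le> C * exp (b * norm u)"
proof -
  obtain k where k: "0 < k" "\<And>x. norm (T x) \<le> norm x * k"
    using bounded_linear.pos_bounded linear_conv_bounded_linear lin by blast
  \<comment> \<open>The summand \<open>k\<close> pays for \<open>exp \<bar>x\<bar>\<close>, the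
    summand 2 for \<open>(norm u + 1)\<^sup>2\<close>.\<close>
  define b where "b = k + 2"
  \<comment> \<open>\<open>k\<^sup>2\<close> comes from the Taylor remainder, \<open>k\<close> from
    the term \<open>(s \<bullet> T s) / 2\<close>, and 1 makes room for \<open>exp k\<close> in the
    bound on the weight.\<close>
  define C where "C = (1 + k + k\<^sup>2) * exp b"
  have C: "1 + k + k\<^sup>2 \<le> C" "exp k \<le> C"
  proof -
    have 1: "1 \<le> 1 + k + k\<^sup>2" "1 \<le> exp b" "exp k \<le> exp b" using k(1) by (auto simp: b_def)
    have "(1 + k + k\<^sup>2) * 1 \<le> C" unfolding C_def using 1 by (intro mult_left_mono) auto
    then show "1 + k + k\<^sup>2 \<le> C" by simp
    have "1 * exp k \<le> C" unfolding C_def using 1 by (intro mult_mono) auto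
    then show "exp k \<le> C" by simp
  qed
  have b: "0 \<le> b" "1 \<le> exp (b * norm u)" for u :: 'a using k(1) by (auto simp: b_def)
  have x: "\<bar>u \<bullet> T s - (s \<bullet> T s) / 2\<bar> \<le> k * norm s * (norm u + 1)"
    and ss: "\<bar>(s \<bullet> T s) / 2\<bar> \<le> k * (norm s)\<^sup>2" if "norm s \<le> 1" for u s
  proof -
    have i: "\<bar>v \<bullet> T s\<bar> \<le> norm v * (norm s * k)" for v
      using Cauchy_Schwarz_ineq2[of v "T s"] k(2)[of s] by (meson mult_left_mono norm_ge_zero order_trans)
    have "norm s * (norm s * k) \<le> 1 * (norm s * k)"
      using that k(1) by (intro mult_right_mono) auto
    then show "\<bar>u \<bullet> T s - (s \<bullet> T s) / 2\<bar> \<le> k * norm s * (norm u + 1)"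
      using i[of u] i[of s] by (simp add: algebra_simps abs_if split: if_splits)
    show "\<bar>(s \<bullet> T s) / 2\<bar> \<le> k * (norm s)\<^sup>2"
      using i[of s] by (simp add: power2_eq_square mult_ac)
  qed
  show thesis
  proof (rule that[of C b])
    show C0: "0 \<le> C" using k(1) by (auto simp: C_def intro!: mult_nonneg_nonneg)
    show "0 \<le> b" by (rule b)
    fix u :: 'a
    have r: "norm u \<le> exp (norm u)" using exp_ge_add_one_self[of "norm u"] by linarith
    show "norm (T u) \<le> C * exp (b * norm u)"
    proof -
      have "exp (norm u) \<le> exp (b * norm u)"
        using k(1) by (auto simp: b_def mult_le_cancel_right1)
      with r have "norm u \<le> exp (b * norm u)" by linarith
      moreover have "k \<le> C" using C(1) k(1) by (smt (verit) zero_le_power2)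
      ultimately have "norm u * k \<le> exp (b * norm u) * C" using k(1) by (intro mult_mono) auto
      with k(2)[of u] show ?thesis by (simp add: mult.commute)
    qed
    fix s :: 'a assume s: "norm s \<le> 1"
    define x where "x = u \<bullet> T s - (s \<bullet> T s) / 2"
    have x1: "\<bar>x\<bar> \<le> k * norm s * (norm u + 1)" unfolding x_def by (rule x[OF s])
    also have "\<dots> \<le> k * 1 * (norm u + 1)" using s k(1) by (intro mult_mono) auto
    finally have x2: "\<bar>x\<bar> \<le> k * (norm u + 1)" by simp
    have "exp x \<le> exp (k * (norm u + 1))" using x2 by auto
    also have "\<dots> = exp k * exp (k * norm u)" by (simp add: exp_add[symmetric] algebra_simps)
    also have "\<dots> \<le> C * exp (b * norm u)"
      using C(2) C0 by (intro mult_mono) (auto simp: b_def mult_right_mono)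
    finally show "exp (u \<bullet> T s - (s \<bullet> T s) / 2) \<le> C * exp (b * norm u)" by (simp add: x_def)
    have "x\<^sup>2 \<le> (k * norm s * (norm u + 1))\<^sup>2" using x1 by (simp only: abs_le_square_iff[symmetric])
    also have "\<dots> = k\<^sup>2 * (norm u + 1)\<^sup>2 * (norm s)\<^sup>2" by (simp add: power_mult_distrib mult_ac)
    also have "\<dots> \<le> k\<^sup>2 * exp (2 * (norm u + 1)) * (norm s)\<^sup>2"
    proof -
      have "(norm u + 1)\<^sup>2 \<le> (exp (norm u + 1))\<^sup>2"
        using exp_ge_add_one_self[of "norm u + 1"] by (intro power_mono) (linarith, simp)
      also have "\<dots> = exp (2 * (norm u + 1))" by (rule exp_double[symmetric])
      finally show ?thesis by (intro mult_right_mono mult_left_mono) auto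
    qed
    finally have xx: "x\<^sup>2 \<le> k\<^sup>2 * exp (2 * (norm u + 1)) * (norm s)\<^sup>2" .
    have "\<bar>exp x - 1 - x\<bar> \<le> x\<^sup>2 * exp \<bar>x\<bar>" by (rule abs_exp_minus_one_minus_le)
    also have "\<dots> \<le> (k\<^sup>2 * exp (2 * (norm u + 1)) * (norm s)\<^sup>2) * exp (k * (norm u + 1))"
      using xx x2 by (intro mult_mono) auto
    also have "\<dots> = k\<^sup>2 * exp b * exp (b * norm u) * (norm s)\<^sup>2"
      by (simp add: b_def exp_add[symmetric] algebra_simps)
    finally have e: "\<bar>exp x - 1 - x\<bar> \<le> k\<^sup>2 * exp b * exp (b * norm u) * (norm s)\<^sup>2" .
    have "k * 1 \<le> k * (exp b * exp (b * norm u))"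
      using k(1) b(1) b(2)[of u] by (intro mult_left_mono) (auto simp: exp_add[symmetric])
    then have "k * (norm s)\<^sup>2 \<le> k * (exp b * exp (b * norm u)) * (norm s)\<^sup>2"
      by (intro mult_right_mono) auto
    then have "\<bar>exp x - 1 - u \<bullet> T s\<bar> \<le> (k + k\<^sup>2) * exp b * exp (b * norm u) * (norm s)\<^sup>2"
      using e ss[OF s] unfolding x_def by (simp add: algebra_simps)
    also have "\<dots> \<le> C * exp (b * norm u) * (norm s)\<^sup>2"
      unfolding C_def by (intro mult_right_mono) auto
    finally show "\<bar>exp (u \<bullet> T s - (s \<bullet> T s) / 2) - 1 - u \<bullet> T s\<bar> \<le> C * exp (b * norm u) * (norm s)\<^sup>2"
      by (simp add: x_def)
  qed
qed

text \<open>After translation the base point occurs only in the Gaussian weight, so the derivative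
  falls on the weight and \<open>f\<close> needs no smoothness. The quadratic remainder of the
  weight, integrated against \<open>\<bar>g u\<bar>\<close>, bounds the error of the linear
  approximation.\<close>

lemma GDERIV_smoothing:
  fixes f :: "'a \<Rightarrow> real"
  assumes [measurable]: "f \<in> borel_measurable borel" and \<mu>: "0 < \<mu>"
    and growth: "\<And>u. \<bar>f (z + \<mu> *\<^sub>R u)\<bar> \<le> K * exp (a * norm u)"
  shows "GDERIV (\<lambda>x. \<integral>u. f (x + \<mu> *\<^sub>R u) \<partial>\<gamma>) z :> (\<integral>u. (f (z + \<mu> *\<^sub>R u) / \<mu>) *\<^sub>R T u \<partial>\<gamma>)"
proof -
  obtain C b where C: "0 \<le> C" "0 \<le> b"
    and T_le: "\<And>u. norm (T u) \<le> C * exp (b * norm u)"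
    and expand: "\<And>u s. norm s \<le> 1 \<Longrightarrow>
      \<bar>exp (u \<bullet> T s - (s \<bullet> T s) / 2) - 1 - u \<bullet> T s\<bar> \<le> C * exp (b * norm u) * (norm s)\<^sup>2"
    and weight: "\<And>u s. norm s \<le> 1 \<Longrightarrow> exp (u \<bullet> T s - (s \<bullet> T s) / 2) \<le> C * exp (b * norm u)"
    using exp_weight_expansion by blast
  define g where "g u = f (z + \<mu> *\<^sub>R u)" for u
  have [measurable]: "g \<in> borel_measurable borel" unfolding g_def by measurable
  have K: "0 \<le> K" using growth[of 0] by simp
  have g_le: "\<bar>g u\<bar> \<le> K * exp (a * norm u)" for u using growth by (simp add: g_def)
  have prod_le: "\<bar>g u\<bar> * r \<le> K * C * exp ((a + b) * norm u)" if "0 \<le> r" "r \<le> C * exp (b * norm u)" for u r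
  proof -
    have "\<bar>g u\<bar> * r \<le> (K * exp (a * norm u)) * (C * exp (b * norm u))"
      using g_le[of u] that K by (intro mult_mono) auto
    then show ?thesis by (simp add: exp_add algebra_simps)
  qed
  define D where "D = (\<integral>u. (g u / \<mu>) *\<^sub>R T u \<partial>\<gamma>)"
  have int_gT: "integrable \<gamma> (\<lambda>u. g u *\<^sub>R T u)"
    by (rule integrable_exp_bounded[where K="K * C" and a="a + b"]) (use prod_le T_le in auto)
  have int_g: "integrable \<gamma> g"
    by (rule integrable_exp_bounded[where K=K and a=a]) (use g_le in auto)
  have int_w: "integrable \<gamma> (\<lambda>u. g u * exp (u \<bullet> T s - (s \<bullet> T s) / 2))" if "norm s \<le> 1" for s
    by (rule integrable_exp_bounded[where K="K * C" and a="a + b"])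
       (use prod_le weight[OF that] in \<open>auto simp: abs_mult\<close>)
  define R where "R = (\<integral>u. \<bar>g u\<bar> * (C * exp (b * norm u)) \<partial>\<gamma>)"
  have int_R: "integrable \<gamma> (\<lambda>u. \<bar>g u\<bar> * (C * exp (b * norm u)))"
    by (rule integrable_exp_bounded[where K="K * C" and a="a + b"])
       (use prod_le C in \<open>auto simp: abs_mult\<close>)
  have D_eq: "D = (1 / \<mu>) *\<^sub>R (\<integral>u. g u *\<^sub>R T u \<partial>\<gamma>)"
    unfolding D_def by (subst integral_scaleR_right[symmetric]) (simp add: field_simps)
  define S where "S x = (\<integral>u. f (x + \<mu> *\<^sub>R u) \<partial>\<gamma>)" for x
  \<comment> \<open>The radius \<open>\<mu>\<close> corresponds to \<open>norm s \<le> 1\<close> for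
    the rescaled increment \<open>s\<close>, the range in which the weight expansion holds.\<close>
  have remainder: "\<bar>S y - S z - (y - z) \<bullet> D\<bar> \<le> R / \<mu>\<^sup>2 * (norm (y - z))\<^sup>2" if "dist y z < \<mu>" for y
  proof -
    define s where "s = (y - z) /\<^sub>R \<mu>"
    have y: "y - z = \<mu> *\<^sub>R s" "y = z + \<mu> *\<^sub>R s" using \<mu> by (simp_all add: s_def)
    have ns: "norm s = norm (y - z) / \<mu>" using \<mu> by (simp add: s_def divide_inverse mult.commute)
    then have s: "norm s \<le> 1" using that \<mu> ns by (simp add: dist_norm)
    have swap: "s \<bullet> T u = u \<bullet> T s" for u using sym[of u s] by (simp add: inner_commute)
    have "S y = (\<integral>u. g (u + s) \<partial>\<gamma>)" unfolding S_def g_def y(2) by (simp add: algebra_simps)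
    also have "\<dots> = (\<integral>u. g u * exp (u \<bullet> T s - (s \<bullet> T s) / 2) \<partial>\<gamma>)"
      by (rule integral_translate) measurable
    finally have Sy: "S y = \<dots>" .
    have Sz: "S z = (\<integral>u. g u \<partial>\<gamma>)" by (simp add: S_def g_def)
    have "(y - z) \<bullet> D = s \<bullet> (\<integral>u. g u *\<^sub>R T u \<partial>\<gamma>)" using \<mu> by (simp add: y(1) D_eq)
    also have "\<dots> = (\<integral>u. s \<bullet> (g u *\<^sub>R T u) \<partial>\<gamma>)" by (rule integral_inner_right[symmetric]) (use int_gT in simp)
    also have "\<dots> = (\<integral>u. g u * (u \<bullet> T s) \<partial>\<gamma>)" by (simp add: swap)
    finally have yD: "(y - z) \<bullet> D = \<dots>" .
    have int_s: "integrable \<gamma> (\<lambda>u. g u * (u \<bullet> T s))"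
      using integrable_inner_right[of s \<gamma> "\<lambda>u. g u *\<^sub>R T u"] int_gT
      by (simp add: swap)
    have "S y - S z - (y - z) \<bullet> D
        = (\<integral>u. g u * exp (u \<bullet> T s - (s \<bullet> T s) / 2) - g u - g u * (u \<bullet> T s) \<partial>\<gamma>)"
      using int_w[OF s] int_g int_s by (simp add: Sy Sz yD)
    also have "\<bar>\<dots>\<bar> \<le> (\<integral>u. \<bar>g u * exp (u \<bullet> T s - (s \<bullet> T s) / 2) - g u - g u * (u \<bullet> T s)\<bar> \<partial>\<gamma>)"
      by (rule integral_abs_bound)
    also have "\<dots> \<le> (\<integral>u. \<bar>g u\<bar> * (C * exp (b * norm u)) * (norm s)\<^sup>2 \<partial>\<gamma>)"
    proof (rule integral_mono)
      fix u
      have "\<bar>g u * exp (u \<bullet> T s - (s \<bullet> T s) / 2) - g u - g u * (u \<bullet> T s)\<bar>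
          = \<bar>g u\<bar> * \<bar>exp (u \<bullet> T s - (s \<bullet> T s) / 2) - 1 - u \<bullet> T s\<bar>"
        by (simp add: abs_mult[symmetric] algebra_simps)
      also have "\<dots> \<le> \<bar>g u\<bar> * (C * exp (b * norm u) * (norm s)\<^sup>2)"
        by (intro mult_left_mono expand s) auto
      finally show "\<bar>g u * exp (u \<bullet> T s - (s \<bullet> T s) / 2) - g u - g u * (u \<bullet> T s)\<bar>
          \<le> \<bar>g u\<bar> * (C * exp (b * norm u)) * (norm s)\<^sup>2" by (simp add: mult_ac)
    qed (use int_w[OF s] int_g int_s int_R in auto)
    also have "\<dots> = R * (norm s)\<^sup>2" unfolding R_def by simp
    finally show ?thesis by (simp add: ns power_divide)
  qed
  have "(S has_derivative (\<lambda>h. h \<bullet> D)) (at z within UNIV)"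
  proof (rule has_derivativeI_sandwich[OF \<mu>, where H="\<lambda>y. R / \<mu>\<^sup>2 * norm (y - z)"])
    show "bounded_linear (\<lambda>h. h \<bullet> D)" by (rule bounded_linear_inner_left)
    fix y assume "y \<noteq> z" "dist y z < \<mu>"
    then show "norm (S y - S z - (y - z) \<bullet> D) / norm (y - z) \<le> R / \<mu>\<^sup>2 * norm (y - z)"
      using remainder[of y] by (simp add: divide_le_eq power2_eq_square mult.assoc)
  next
    show "((\<lambda>y. R / \<mu>\<^sup>2 * norm (y - z)) \<longlongrightarrow> 0) (at z within UNIV)"
      by (rule tendsto_eq_intros refl | simp)+
  qed
  then show ?thesis by (simp add: gderiv_def D_def g_def S_def[abs_def])
qed

lemma T_mean_zero: "integrable \<gamma> T" "(\<integral>u. T u \<partial>\<gamma>) = 0"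
proof -
  obtain C b where T_le: "\<And>u. norm (T u) \<le> C * exp (b * norm u)"
    using exp_weight_expansion by metis
  show "integrable \<gamma> T"
    by (rule integrable_exp_bounded[where K=C and a=b]) (use T_le in auto)
  \<comment> \<open>the gradient formula, applied to a constant function\<close>
  have "GDERIV (\<lambda>x. \<integral>u. (1::real) \<partial>\<gamma>) (0::'a) :> (\<integral>u. (1 / 1) *\<^sub>R T u \<partial>\<gamma>)"
    by (rule GDERIV_smoothing[where \<mu>=1 and f="\<lambda>_. 1" and K=1 and a=0]) auto
  from grad_eqI[OF this] show "(\<integral>u. T u \<partial>\<gamma>) = 0"
    by (simp add: grad_eqI[OF GDERIV_const])
qed

text \<open>Since \<open>T u\<close> has mean zero, \<open>f z\<close> may be subtracted inside the
  integral, which turns the gradient formula into the mean of the difference-quotient oracle.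
  Lipschitz continuity supplies the growth bound.\<close>

lemma GDERIV_smoothing_Lipschitz:
  fixes f :: "'a \<Rightarrow> real"
  assumes \<mu>: "0 < \<mu>" and lip: "\<And>v w. \<bar>f v - f w\<bar> \<le> L * norm (v - w)"
  shows "GDERIV (\<lambda>x. \<integral>u. f (x + \<mu> *\<^sub>R u) \<partial>\<gamma>) z :> (\<integral>u. ((f (z + \<mu> *\<^sub>R u) - f z) / \<mu>) *\<^sub>R T u \<partial>\<gamma>)"
proof -
  \<comment> \<open>\<open>lipschitz_on\<close> asks for a nonnegative constant, while no sign is
    assumed for \<open>L\<close>.\<close>
  define L' where "L' = max L 0"
  have lip': "\<bar>f v - f w\<bar> \<le> L' * norm (v - w)" for v w
    using lip[of v w] mult_right_mono[of L L' "norm (v - w)"] by (simp add: L'_def)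
  have "L'-lipschitz_on UNIV f"
    using lip' by (intro lipschitz_onI) (auto simp: dist_norm L'_def)
  then have "continuous_on UNIV f" by (rule lipschitz_on_continuous_on)
  then have [measurable]: "f \<in> borel_measurable borel" by (rule borel_measurable_continuous_onI)
  define K where "K = \<bar>f z\<bar> + L' * \<mu>"
  have growth: "\<bar>f (z + \<mu> *\<^sub>R u)\<bar> \<le> K * exp (1 * norm u)" for u
  proof -
    have "\<bar>f (z + \<mu> *\<^sub>R u)\<bar> \<le> \<bar>f z\<bar> * 1 + L' * \<mu> * norm u"
      using lip'[of "z + \<mu> *\<^sub>R u" z] \<mu> by simp
    also have "\<dots> \<le> \<bar>f z\<bar> * exp (norm u) + L' * \<mu> * exp (norm u)"
    proof (intro add_mono mult_left_mono)
      show "norm u \<le> exp (norm u)" using exp_ge_add_one_self[of "norm u"] by linarith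
    qed (use \<mu> in \<open>auto simp: L'_def\<close>)
    finally show ?thesis by (simp add: K_def algebra_simps)
  qed
  obtain C b where C: "0 \<le> C" and T_le: "\<And>u. norm (T u) \<le> C * exp (b * norm u)"
    using exp_weight_expansion by metis
  have int: "integrable \<gamma> (\<lambda>u. (f (z + \<mu> *\<^sub>R u) / \<mu>) *\<^sub>R T u)"
  proof (rule integrable_exp_bounded[where K="K * C / \<mu>" and a="1 + b"])
    fix u
    have "\<bar>f (z + \<mu> *\<^sub>R u)\<bar> * norm (T u) \<le> (K * exp (1 * norm u)) * (C * exp (b * norm u))"
      using growth[of u] T_le[of u] C by (intro mult_mono) (auto intro: order_trans[OF abs_ge_zero])
    then show "norm ((f (z + \<mu> *\<^sub>R u) / \<mu>) *\<^sub>R T u) \<le> K * C / \<mu> * exp ((1 + b) * norm u)"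
      using \<mu> by (simp add: exp_add field_simps)
  qed measurable
  have "(\<integral>u. ((f (z + \<mu> *\<^sub>R u) - f z) / \<mu>) *\<^sub>R T u \<partial>\<gamma>)
      = (\<integral>u. (f (z + \<mu> *\<^sub>R u) / \<mu>) *\<^sub>R T u - (f z / \<mu>) *\<^sub>R T u \<partial>\<gamma>)"
    by (simp add: scaleR_left_diff_distrib diff_divide_distrib)
  also have "\<dots> = (\<integral>u. (f (z + \<mu> *\<^sub>R u) / \<mu>) *\<^sub>R T u \<partial>\<gamma>)"
    using int T_mean_zero by simp
  finally show ?thesis
    using GDERIV_smoothing[of f \<mu> z K 1] \<mu> growth by simp
qed

text \<open>The function being squared dominates the oracle of an \<open>L\<close>-Lipschitz
  function at every base point; its square integrability later provides the envelope
  \<open>b\<close> of the oracle.\<close>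

lemma oracle_bound_square_integrable: "integrable \<gamma> (\<lambda>u. (L * norm u * norm (T u))\<^sup>2)"
proof -
  obtain C b where C: "0 \<le> C" and T_le: "\<And>u. norm (T u) \<le> C * exp (b * norm u)"
    using exp_weight_expansion by metis
  show ?thesis
  proof (rule integrable_exp_bounded[where K="(\<bar>L\<bar> * C)\<^sup>2" and a="2 * (1 + b)"])
    fix u
    have "norm u * norm (T u) \<le> exp (norm u) * (C * exp (b * norm u))"
      using T_le[of u] exp_ge_add_one_self[of "norm u"] by (intro mult_mono) (linarith, auto)
    then have "\<bar>L\<bar> * (norm u * norm (T u)) \<le> \<bar>L\<bar> * (exp (norm u) * (C * exp (b * norm u)))"
      by (rule mult_left_mono) simp
    then have "\<bar>L * norm u * norm (T u)\<bar> \<le> \<bar>L\<bar> * C * exp ((1 + b) * norm u)"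
      by (simp add: abs_mult exp_add algebra_simps)
    then have "\<bar>L * norm u * norm (T u)\<bar>\<^sup>2 \<le> (\<bar>L\<bar> * C * exp ((1 + b) * norm u))\<^sup>2"
      by (rule power_mono) simp
    also have "\<dots> = (\<bar>L\<bar> * C)\<^sup>2 * exp (2 * ((1 + b) * norm u))"
      by (simp only: power_mult_distrib exp_double)
    finally show "norm ((L * norm u * norm (T u))\<^sup>2) \<le> (\<bar>L\<bar> * C)\<^sup>2 * exp (2 * (1 + b) * norm u)"
      by (simp only: mult.assoc real_norm_def power2_abs abs_power2)
  qed measurable
qed

end

section \<open>Batches of independent oracle calls\<close>

context prob_space
begin

definition square_integrable :: "('a \<Rightarrow> 'b::euclidean_space) \<Rightarrow> bool" where
  "square_integrable X \<longleftrightarrow> X \<in> borel_measurable M \<and> integrable M (\<lambda>w. (norm (X w))\<^sup>2)"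

lemma square_integrable_measurable [measurable_dest]: "square_integrable X \<Longrightarrow> X \<in> borel_measurable M"
  by (simp add: square_integrable_def)

lemma square_integrable_cong:
  "(\<And>w. w \<in> space M \<Longrightarrow> X w = Y w) \<Longrightarrow> square_integrable X \<longleftrightarrow> square_integrable Y"
  unfolding square_integrable_def
  by (intro conj_cong measurable_cong Bochner_Integration.integrable_cong) auto

lemma square_integrable_dominated:
  assumes Y: "square_integrable Y" and [measurable]: "X \<in> borel_measurable M"
    and le: "\<And>w. w \<in> space M \<Longrightarrow> norm (X w) \<le> norm (Y w)"
  shows "square_integrable X"
proof -
  have "integrable M (\<lambda>w. (norm (Y w))\<^sup>2)" using Y by (simp add: square_integrable_def)
  then have "integrable M (\<lambda>w. (norm (X w))\<^sup>2)"
    by (rule Bochner_Integration.integrable_bound) (auto intro!: power_mono le)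
  then show ?thesis by (simp add: square_integrable_def)
qed

lemma square_integrable_bounded:
  assumes "X \<in> borel_measurable M" and "\<And>w. w \<in> space M \<Longrightarrow> norm (X w) \<le> K"
  shows "square_integrable X"
  by (rule square_integrable_dominated[where Y="\<lambda>_. K"])
     (use assms in \<open>auto simp: square_integrable_def intro: order_trans[OF _ abs_ge_self]\<close>)

lemma square_integrable_scaleR: "square_integrable X \<Longrightarrow> square_integrable (\<lambda>w. a *\<^sub>R X w)"
  unfolding square_integrable_def
  by (auto simp: power_mult_distrib intro!: borel_measurable_scaleR borel_measurable_const)

lemma square_integrable_inner:
  assumes X: "square_integrable X" and Y: "square_integrable Y"
  shows "integrable M (\<lambda>w. X w \<bullet> Y w)"
proof (rule Bochner_Integration.integrable_bound)
  show "integrable M (\<lambda>w. (norm (X w))\<^sup>2 + (norm (Y w))\<^sup>2)"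
    using X Y by (simp add: square_integrable_def)
  have "\<bar>x \<bullet> y\<bar> \<le> (norm x)\<^sup>2 + (norm y)\<^sup>2" for x y :: 'b
  proof -
    have "2 * (norm x * norm y) \<le> (norm x)\<^sup>2 + (norm y)\<^sup>2"
      using sum_squares_bound[of "norm x" "norm y"] by simp
    moreover have "0 \<le> norm x * norm y" by simp
    ultimately show ?thesis using Cauchy_Schwarz_ineq2[of x y] by linarith
  qed
  then show "AE w in M. norm (X w \<bullet> Y w) \<le> norm ((norm (X w))\<^sup>2 + (norm (Y w))\<^sup>2)"
    by (auto intro: order_trans[OF _ abs_ge_self])
qed (use X Y in measurable)

lemma square_integrable_add:
  assumes X: "square_integrable X" and Y: "square_integrable Y"
  shows "square_integrable (\<lambda>w. X w + Y w)"
proof -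
  have "(\<lambda>w. (norm (X w + Y w))\<^sup>2) = (\<lambda>w. (norm (X w))\<^sup>2 + (norm (Y w))\<^sup>2 + 2 * (X w \<bullet> Y w))"
    by (simp add: power2_norm_eq_inner inner_add_left inner_add_right inner_commute fun_eq_iff)
  moreover have "integrable M \<dots>"
    using X Y square_integrable_inner[OF X Y] by (simp add: square_integrable_def)
  moreover have "(\<lambda>w. X w + Y w) \<in> borel_measurable M" using X Y by measurable
  ultimately show ?thesis by (simp add: square_integrable_def)
qed

lemma square_integrable_diff:
  "square_integrable X \<Longrightarrow> square_integrable Y \<Longrightarrow> square_integrable (\<lambda>w. X w - Y w)"
  using square_integrable_add[of X "\<lambda>w. - 1 *\<^sub>R Y w"] square_integrable_scaleR[of Y "- 1"] by simp

lemma square_integrable_sum: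
  "(\<And>i. i \<in> A \<Longrightarrow> square_integrable (X i)) \<Longrightarrow> square_integrable (\<lambda>w. \<Sum>i\<in>A. X i w)"
proof (induction A rule: infinite_finite_induct)
  case (insert i A)
  then show ?case using square_integrable_add[of "X i" "\<lambda>w. \<Sum>i\<in>A. X i w"] by simp
qed (auto simp: square_integrable_def)

end

section \<open>Independent samples and the sigma-algebras of the past\<close>

locale sampling = prob_space M for M :: "'w measure" +
  fixes V :: "'i \<Rightarrow> 'w \<Rightarrow> 'u::euclidean_space" and I :: "'i set" and \<gamma> :: "'u measure"
  assumes indep: "indep_vars (\<lambda>_. borel) V I"
    and law: "\<And>i. i \<in> I \<Longrightarrow> distr M borel (V i) = \<gamma>"
begin

text \<open>The sigma-algebra generated by the samples with index in \<open>J\<close>. Only its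
  measurable sets matter; encoding it as a measure lets dependence on earlier samples be stated as
  ordinary measurability.\<close>

definition past :: "'i set \<Rightarrow> 'w measure" where
  "past J = vimage_algebra (space M) (\<lambda>w. restrict (\<lambda>i. V i w) J) (PiM J (\<lambda>_. borel))"

lemma space_past [simp]: "space (past J) = space M"
  by (simp add: past_def)

lemma V_measurable: "i \<in> I \<Longrightarrow> V i \<in> borel_measurable M"
  using indep by (simp add: indep_vars_def)

lemma measurable_id_past: "J \<subseteq> I \<Longrightarrow> (\<lambda>w. w) \<in> measurable M (past J)"
  unfolding past_def by (rule measurable_vimage_algebra2) (auto intro!: measurable_restrict V_measurable)

lemma measurable_pastD: "J \<subseteq> I \<Longrightarrow> X \<in> measurable (past J) N \<Longrightarrow> X \<in> measurable M N"
  using measurable_compose[OF measurable_id_past] .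

lemma measurable_past_sample: "i \<in> J \<Longrightarrow> V i \<in> borel_measurable (past J)"
proof -
  assume i: "i \<in> J"
  have "(\<lambda>w. restrict (\<lambda>i. V i w) J) \<in> measurable (past J) (PiM J (\<lambda>_. borel))"
    unfolding past_def by (rule measurable_vimage_algebra1) (auto simp: space_PiM)
  from measurable_compose[OF this measurable_component_singleton[OF i]] show ?thesis
    using i by simp
qed

lemma measurable_past_mono:
  assumes "J \<subseteq> J'" and "X \<in> measurable (past J) N"
  shows "X \<in> measurable (past J') N"
proof -
  have "(\<lambda>w. w) \<in> measurable (past J') (past J)"
    unfolding past_def[of J]
    by (rule measurable_vimage_algebra2)
       (use assms(1) in \<open>auto intro!: measurable_restrict measurable_past_sample\<close>)
  from measurable_compose[OF this assms(2)] show ?thesis .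
qed

text \<open>The index sets \<open>J\<close> and \<open>{i}\<close> are disjoint, so the
  corresponding subfamilies of samples generate independent sigma-algebras.\<close>

lemma prob_past_fresh:
  assumes J: "J \<subseteq> I" and i: "i \<in> I - J" and A: "A \<in> sets (past J)" and B: "B \<in> sets borel"
  shows "prob (A \<inter> (V i -` B \<inter> space M)) = prob A * prob (V i -` B \<inter> space M)"
proof -
  let ?Y = "\<lambda>J w. restrict (\<lambda>i. V i w) J" and ?P = "\<lambda>J. PiM J (\<lambda>_. borel :: 'u measure)"
  have "indep_var (?P J) (?Y J) (?P {i}) (?Y {i})"
    by (rule indep_var_restrict[OF indep]) (use J i in auto)
  then have ind: "indep_set
      (sigma_sets (space M) {?Y J -` A \<inter> space M | A. A \<in> sets (?P J)})
      (sigma_sets (space M) {?Y {i} -` A \<inter> space M | A. A \<in> sets (?P {i})})"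
    by (simp add: indep_var_eq)
  have "A \<in> {?Y J -` A \<inter> space M | A. A \<in> sets (?P J)}"
    using A unfolding past_def by (subst (asm) sets_vimage_algebra2) (auto simp: space_PiM)
  moreover have "(\<lambda>x. x i) -` B \<inter> space (?P {i}) \<in> sets (?P {i})"
    using B by (intro measurable_sets[OF measurable_component_singleton]) auto
  then have "?Y {i} -` ((\<lambda>x. x i) -` B \<inter> space (?P {i})) \<inter> space M
      \<in> {?Y {i} -` A \<inter> space M | A. A \<in> sets (?P {i})}" by blast
  moreover have "?Y {i} -` ((\<lambda>x. x i) -` B \<inter> space (?P {i})) \<inter> space M = V i -` B \<inter> space M"
    by (auto simp: space_PiM)
  ultimately show ?thesis
    by (intro indep_setD[OF ind] sigma_sets.Basic) auto
qed

text \<open>The freezing lemma, standing in for conditional expectation given the past: the joint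
  law of the past and a fresh sample is a product measure, so Fubini integrates out the sample with
  the past held fixed.\<close>

lemma expectation_fresh:
  fixes \<phi> :: "'w \<Rightarrow> 'u \<Rightarrow> real"
  assumes J: "J \<subseteq> I" and i: "i \<in> I - J"
    and \<phi>: "case_prod \<phi> \<in> borel_measurable (past J \<Otimes>\<^sub>M borel)"
    and int: "integrable M (\<lambda>w. \<phi> w (V i w))"
  shows "integrable M (\<lambda>w. \<integral>u. \<phi> w u \<partial>\<gamma>)"
    and "expectation (\<lambda>w. \<phi> w (V i w)) = expectation (\<lambda>w. \<integral>u. \<phi> w u \<partial>\<gamma>)"
proof -
  have [measurable]: "V i \<in> borel_measurable M" using V_measurable i by auto
  note id [measurable] = measurable_id_past[OF J]
  interpret P: prob_space "distr M (past J) (\<lambda>w. w)" by (rule prob_space_distr) measurable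
  have law: "\<gamma> = distr M borel (V i)" using law i by simp
  interpret G: prob_space \<gamma> unfolding law by (rule prob_space_distr) measurable
  interpret PG: pair_prob_space "distr M (past J) (\<lambda>w. w)" \<gamma> ..
  have pair: "(\<lambda>w. (w, V i w)) \<in> measurable M (past J \<Otimes>\<^sub>M borel)" by measurable
  \<comment> \<open>It suffices to compare both measures on rectangles, where the equality is
    independence of the past and the fresh sample.\<close>
  have joint: "distr M (past J) (\<lambda>w. w) \<Otimes>\<^sub>M \<gamma> = distr M (past J \<Otimes>\<^sub>M borel) (\<lambda>w. (w, V i w))"
  proof (rule pair_measure_eqI)
    show "sets (distr M (past J) (\<lambda>w. w) \<Otimes>\<^sub>M \<gamma>) = sets (distr M (past J \<Otimes>\<^sub>M borel) (\<lambda>w. (w, V i w)))"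
      unfolding law by (simp cong: sets_pair_measure_cong)
    fix A B assume "A \<in> sets (distr M (past J) (\<lambda>w. w))" "B \<in> sets \<gamma>"
    then have A: "A \<in> sets (past J)" and B: "B \<in> sets borel" by (simp_all add: law)
    have AM: "A \<inter> space M = A" using sets.sets_into_space[OF A] by auto
    have "(\<lambda>w. (w, V i w)) -` (A \<times> B) \<inter> space M = A \<inter> (V i -` B \<inter> space M)" using AM by auto
    then show "emeasure (distr M (past J) (\<lambda>w. w)) A * emeasure \<gamma> B
        = emeasure (distr M (past J \<Otimes>\<^sub>M borel) (\<lambda>w. (w, V i w))) (A \<times> B)"
      unfolding law using A B AM
      by (simp add: emeasure_distr[OF pair] emeasure_distr[OF id] emeasure_distr emeasure_eq_measure
          prob_past_fresh[OF J i] ennreal_mult'[symmetric])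
  qed (unfold_locales)
  have I: "integrable (distr M (past J) (\<lambda>w. w) \<Otimes>\<^sub>M \<gamma>) (case_prod \<phi>)"
    unfolding joint using int by (simp add: integrable_distr_eq[OF pair \<phi>])
  have inner: "(\<lambda>w. \<integral>u. \<phi> w u \<partial>\<gamma>) \<in> borel_measurable (past J)"
    using PG.integrable_fst'[OF I] by (simp add: borel_measurable_integrable cong: measurable_cong_sets)
  show "integrable M (\<lambda>w. \<integral>u. \<phi> w u \<partial>\<gamma>)"
    using PG.integrable_fst'[OF I] id inner by (simp add: integrable_distr_eq)
  have "expectation (\<lambda>w. \<phi> w (V i w)) = (\<integral>p. case_prod \<phi> p \<partial>(distr M (past J) (\<lambda>w. w) \<Otimes>\<^sub>M \<gamma>))"
    unfolding joint by (simp add: integral_distr[OF pair \<phi>])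
  also have "\<dots> = (\<integral>w. (\<integral>u. \<phi> w u \<partial>\<gamma>) \<partial>distr M (past J) (\<lambda>w. w))"
    using PG.integral_fst'[OF I] by simp
  also have "\<dots> = expectation (\<lambda>w. \<integral>u. \<phi> w u \<partial>\<gamma>)"
    using id inner by (simp add: integral_distr)
  finally show "expectation (\<lambda>w. \<phi> w (V i w)) = expectation (\<lambda>w. \<integral>u. \<phi> w u \<partial>\<gamma>)" .
qed

end

section \<open>Unbiased oracles with bounded variance, queried at random points\<close>

locale stochastic_oracle = sampling M V I \<gamma> for M :: "'w measure"
    and V :: "'i \<Rightarrow> 'w \<Rightarrow> 'u::euclidean_space" and I :: "'i set" and \<gamma> :: "'u measure" +
  fixes G :: "'x::euclidean_space \<Rightarrow> 'u \<Rightarrow> 'x" and F :: "'x \<Rightarrow> 'x" and b :: "'u \<Rightarrow> real" and s :: real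
  assumes prob_gamma: "prob_space \<gamma>" and sets_gamma [measurable_cong]: "sets \<gamma> = sets borel"
    and G_measurable: "case_prod G \<in> borel_measurable (borel \<Otimes>\<^sub>M borel)"
    and F_measurable [measurable]: "F \<in> borel_measurable borel"
    and G_bound: "\<And>x u. norm (G x u) \<le> b u"
    and b_measurable [measurable]: "b \<in> borel_measurable borel"
    and b_square: "integrable \<gamma> (\<lambda>u. (b u)\<^sup>2)"
    and G_mean: "\<And>x. (\<integral>u. G x u \<partial>\<gamma>) = F x"
    and G_variance: "\<And>x. (\<integral>u. (norm (G x u - F x))\<^sup>2 \<partial>\<gamma>) \<le> s"
begin

definition noise :: "('w \<Rightarrow> 'x) \<Rightarrow> 'i \<Rightarrow> 'w \<Rightarrow> 'x" where
  "noise X i w = G (X w) (V i w) - F (X w)"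

definition batch_noise :: "('w \<Rightarrow> 'x) \<Rightarrow> 'i set \<Rightarrow> 'w \<Rightarrow> 'x" where
  "batch_noise X A w = (1 / real (card A)) *\<^sub>R (\<Sum>i\<in>A. noise X i w)"

lemma b_nonneg: "0 \<le> b u"
  using G_bound[of undefined u] norm_ge_zero order_trans by blast

lemma b_integrable: "integrable \<gamma> b"
proof -
  interpret \<gamma>: prob_space \<gamma> by (rule prob_gamma)
  show ?thesis by (rule \<gamma>.square_integrable_imp_integrable[OF _ b_square]) measurable
qed

lemma G_measurable_compose [measurable]:
  assumes "X \<in> borel_measurable N" "Y \<in> borel_measurable N"
  shows "(\<lambda>w. G (X w) (Y w)) \<in> borel_measurable N"
  using measurable_compose[OF measurable_Pair[OF assms] G_measurable] by simp

lemma G_integrable: "integrable \<gamma> (G x)"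
  by (rule Bochner_Integration.integrable_bound[OF b_integrable])
     (use G_bound b_nonneg in auto)

definition F_bound :: real where "F_bound = (\<integral>u. b u \<partial>\<gamma>)"

text \<open>\<open>F\<close> is the mean of the oracle and the envelope \<open>b\<close> does not
  depend on the query point. Hence \<open>F\<close> is square integrable along any measurable random
  point.\<close>

lemma F_bounded: "norm (F x) \<le> F_bound"
proof -
  have "norm (F x) \<le> (\<integral>u. norm (G x u) \<partial>\<gamma>)" unfolding G_mean[symmetric] by (rule integral_norm_bound)
  also have "\<dots> \<le> F_bound" unfolding F_bound_def
    by (intro integral_mono integrable_norm G_integrable b_integrable G_bound)
  finally show ?thesis .
qed

lemma square_integrable_F: "X \<in> borel_measurable M \<Longrightarrow> square_integrable (\<lambda>w. F (X w))"
  by (rule square_integrable_bounded[where K=F_bound]) (auto simp: F_bounded)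

text \<open>The envelope depends on the sample alone, so the query point \<open>X\<close> may depend
  on the samples in any measurable way.\<close>

lemma square_integrable_noise:
  assumes [measurable]: "X \<in> borel_measurable M" and i: "i \<in> I"
  shows "square_integrable (noise X i)"
proof -
  have [measurable]: "V i \<in> borel_measurable M" using V_measurable i .
  have "integrable M (\<lambda>w. (b (V i w))\<^sup>2)"
    using b_square unfolding law[OF i, symmetric] by (simp add: integrable_distr_eq)
  then have "square_integrable (\<lambda>w. b (V i w))" by (simp add: square_integrable_def)
  then have "square_integrable (\<lambda>w. G (X w) (V i w))"
    by (rule square_integrable_dominated) (auto intro: order_trans[OF G_bound abs_ge_self])
  then show ?thesis unfolding noise_def by (intro square_integrable_diff square_integrable_F) auto
qed

lemma square_integrable_batch_noise:
  assumes "X \<in> borel_measurable M" "A \<subseteq> I"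
  shows "square_integrable (batch_noise X A)"
  unfolding batch_noise_def
  using assms by (intro square_integrable_scaleR square_integrable_sum square_integrable_noise) auto

context
  fixes J and X :: "'w \<Rightarrow> 'x"
  assumes J: "J \<subseteq> I" and X [measurable]: "X \<in> borel_measurable (past J)"
begin

text \<open>With the past frozen, \<open>X\<close> and \<open>Y\<close> are constants and the oracle
  error at \<open>X\<close> has mean zero.\<close>

lemma expectation_inner_noise:
  assumes i: "i \<in> I - J" and Y [measurable]: "Y \<in> borel_measurable (past J)" and "square_integrable Y"
  shows "expectation (\<lambda>w. Y w \<bullet> noise X i w) = 0"
proof -
  have XM: "X \<in> borel_measurable M" by (rule measurable_pastD[OF J X])
  have "expectation (\<lambda>w. Y w \<bullet> noise X i w) = expectation (\<lambda>w. \<integral>u. Y w \<bullet> (G (X w) u - F (X w)) \<partial>\<gamma>)"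
    unfolding noise_def
  proof (rule expectation_fresh[OF J i])
    show "integrable M (\<lambda>w. Y w \<bullet> (G (X w) (V i w) - F (X w)))"
      using square_integrable_inner[OF \<open>square_integrable Y\<close> square_integrable_noise[OF XM]] i
      by (simp add: noise_def)
  qed measurable
  also have "(\<lambda>w. \<integral>u. Y w \<bullet> (G (X w) u - F (X w)) \<partial>\<gamma>) = (\<lambda>w. 0)"
  proof
    fix w
    interpret \<gamma>: prob_space \<gamma> by (rule prob_gamma)
    have "(\<integral>u. Y w \<bullet> (G (X w) u - F (X w)) \<partial>\<gamma>) = Y w \<bullet> (\<integral>u. G (X w) u - F (X w) \<partial>\<gamma>)"
      using G_integrable by (intro integral_inner_right) auto
    also have "\<dots> = 0" using G_integrable by (simp add: G_mean \<gamma>.prob_space)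
    finally show "(\<integral>u. Y w \<bullet> (G (X w) u - F (X w)) \<partial>\<gamma>) = 0" .
  qed
  finally show ?thesis by simp
qed

lemma expectation_noise_square:
  assumes i: "i \<in> I - J"
  shows "expectation (\<lambda>w. (norm (noise X i w))\<^sup>2) \<le> s"
proof -
  have XM: "X \<in> borel_measurable M" by (rule measurable_pastD[OF J X])
  have m: "(\<lambda>(w, u). (norm (G (X w) u - F (X w)))\<^sup>2) \<in> borel_measurable (past J \<Otimes>\<^sub>M borel)" by measurable
  have int: "integrable M (\<lambda>w. (norm (G (X w) (V i w) - F (X w)))\<^sup>2)"
    using square_integrable_noise[OF XM] i by (simp add: square_integrable_def noise_def)
  have "expectation (\<lambda>w. (norm (noise X i w))\<^sup>2)
      = expectation (\<lambda>w. \<integral>u. (norm (G (X w) u - F (X w)))\<^sup>2 \<partial>\<gamma>)"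
    unfolding noise_def by (rule expectation_fresh[OF J i m int])
  also have "\<dots> \<le> expectation (\<lambda>w. s)"
    using expectation_fresh(1)[OF J i m int] by (intro integral_mono G_variance) auto
  finally show ?thesis by (simp add: prob_space)
qed

lemma expectation_inner_batch_noise:
  assumes A: "A \<subseteq> I - J" and Y: "Y \<in> borel_measurable (past J)" "square_integrable Y"
  shows "expectation (\<lambda>w. Y w \<bullet> batch_noise X A w) = 0"
proof -
  have "integrable M (\<lambda>w. Y w \<bullet> noise X i w)" if "i \<in> A" for i
    using that A by (intro square_integrable_inner Y square_integrable_noise measurable_pastD[OF J X]) auto
  then show ?thesis
    using A by (auto simp: batch_noise_def inner_sum_right expectation_inner_noise Y subset_iff intro!: sum.neutral)
qed

text \<open>Errors of different samples of a batch are orthogonal in mean, so the second moment of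
  their sum is at most \<open>card A * s\<close>; averaging divides this by the square of
  \<open>card A\<close>.\<close>

lemma expectation_batch_noise_square:
  assumes A: "A \<subseteq> I - J" "finite A" "A \<noteq> {}"
  shows "expectation (\<lambda>w. (norm (batch_noise X A w))\<^sup>2) \<le> s / real (card A)"
proof -
  have XM: "X \<in> borel_measurable M" by (rule measurable_pastD[OF J X])
  have D: "square_integrable (noise X i)" if "i \<in> A" for i
    using square_integrable_noise[OF XM] that A by auto
  have orth: "expectation (\<lambda>w. noise X i w \<bullet> noise X j w) = 0" if ij: "i \<in> A" "j \<in> A" "i \<noteq> j" for i j
  proof -
    \<comment> \<open>Moving \<open>i\<close> into the past makes \<open>noise X i\<close>
      past-measurable, while \<open>j\<close> is still fresh.\<close>
    have J': "insert i J \<subseteq> I" using J ij A by auto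
    have X' [measurable]: "X \<in> borel_measurable (past (insert i J))"
      by (rule measurable_past_mono[OF _ X]) auto
    have [measurable]: "V i \<in> borel_measurable (past (insert i J))"
      by (rule measurable_past_sample) auto
    have "noise X i \<in> borel_measurable (past (insert i J))" unfolding noise_def by measurable
    then show ?thesis
      \<comment> \<open>Inside this context the lemma refers to the fixed \<open>J\<close>; its
        exported form is instantiated with the enlarged past.\<close>
      using ij A J' by (intro stochastic_oracle.expectation_inner_noise[OF stochastic_oracle_axioms J' X'] D) auto
  qed
  have "expectation (\<lambda>w. (norm (\<Sum>i\<in>A. noise X i w))\<^sup>2)
      = (\<Sum>i\<in>A. \<Sum>j\<in>A. expectation (\<lambda>w. noise X i w \<bullet> noise X j w))"
    using D unfolding power2_norm_eq_inner inner_sum_left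
    unfolding inner_sum_right by (simp add: square_integrable_inner Bochner_Integration.integral_sum)
  also have "\<dots> = (\<Sum>i\<in>A. \<Sum>j\<in>A. if j = i then expectation (\<lambda>w. (norm (noise X i w))\<^sup>2) else 0)"
    by (intro sum.cong refl) (auto simp: orth power2_norm_eq_inner)
  also have "\<dots> = (\<Sum>i\<in>A. expectation (\<lambda>w. (norm (noise X i w))\<^sup>2))"
    using A by simp
  also have "\<dots> \<le> (\<Sum>i\<in>A. s)" using A by (intro sum_mono expectation_noise_square) auto
  finally have S: "expectation (\<lambda>w. (norm (\<Sum>i\<in>A. noise X i w))\<^sup>2) \<le> real (card A) * s" by simp
  have "expectation (\<lambda>w. (norm (batch_noise X A w))\<^sup>2)
      = (1 / real (card A))\<^sup>2 * expectation (\<lambda>w. (norm (\<Sum>i\<in>A. noise X i w))\<^sup>2)"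
    by (simp add: batch_noise_def power_mult_distrib power_divide)
  also have "\<dots> \<le> (1 / real (card A))\<^sup>2 * (real (card A) * s)"
    by (intro mult_left_mono S) simp
  also have "\<dots> = s / real (card A)"
    using A by (simp add: power2_eq_square)
  finally show ?thesis .
qed

end

lemma batch_average:
  assumes "finite A" "A \<noteq> {}"
  shows "(1 / real (card A)) *\<^sub>R (\<Sum>i\<in>A. G (X w) (V i w)) = F (X w) + batch_noise X A w"
  using assms by (simp add: batch_noise_def noise_def sum_subtractf scaleR_diff_right sum_constant_scaleR)

end

section \<open>The extragradient step\<close>

text \<open>
  The oracle error \<open>e1\<close> also enters through \<open>xh\<close>, so \<open>F xh \<bullet> e1\<close> is not centred. Comparing \<open>F xh\<close>
  with its value at the noise-free point \<open>x - h1 *\<^sub>R F x\<close> leaves a centred term and an error of order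
  \<open>(norm e1)\<^sup>2\<close>.
\<close>

lemma extragradient_pointwise:
  fixes F :: "'a::real_inner \<Rightarrow> 'a"
  assumes lip: "\<And>v w. norm (F v - F w) \<le> L * norm (v - w)"
    and h: "0 \<le> L" "0 \<le> h1" "0 \<le> h2" "L * h1 \<le> 1"
    and minty: "\<And>v. - r * (norm (F v))\<^sup>2 \<le> F v \<bullet> (v - zs)"
    and xh: "xh = x - h1 *\<^sub>R (F x + e1)" and x': "x' = x - h2 *\<^sub>R (F xh + e2)"
  shows "(norm (x' - zs))\<^sup>2 + (h1 * h2 - h2\<^sup>2 - 2 * h2 * r) * (norm (F xh))\<^sup>2
    \<le> (norm (x - zs))\<^sup>2 + 3 * h1 * h2 * (norm e1)\<^sup>2 + h2\<^sup>2 * (norm e2)\<^sup>2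
      - 2 * h1 * h2 * ((F (x - h1 *\<^sub>R F x) - F x) \<bullet> e1)
      - 2 * h2 * ((x - zs - h2 *\<^sub>R F xh) \<bullet> e2)"
proof -
  define p q m g where "p = F xh" and "q = F x" and "m = F (x - h1 *\<^sub>R F x)" and "g = F x + e1"
  have x'_eq: "(norm (x' - zs))\<^sup>2 = (norm (x - zs))\<^sup>2 - 2 * h2 * (p \<bullet> (x - zs)) + h2\<^sup>2 * (norm p)\<^sup>2
      - 2 * h2 * ((x - zs - h2 *\<^sub>R p) \<bullet> e2) + h2\<^sup>2 * (norm e2)\<^sup>2"
    unfolding x' p_def[symmetric] power2_norm_eq_inner
    by (simp add: inner_diff_left inner_diff_right inner_add_left inner_add_right
        inner_commute algebra_simps power2_eq_square)
  \<comment> \<open>The weak Minty inequality is used at the extrapolated point \<open>xh\<close>;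
    the displacement from \<open>xh\<close> to \<open>x\<close> contributes
    \<open>h1 * (p \<bullet> g)\<close>.\<close>
  have "p \<bullet> (x - zs) = p \<bullet> (xh - zs) + h1 * (p \<bullet> g)"
    unfolding xh g_def[symmetric] by (simp add: inner_diff_right)
  then have "h1 * (p \<bullet> g) - r * (norm p)\<^sup>2 \<le> p \<bullet> (x - zs)"
    using minty[of xh] by (simp add: p_def)
  then have "2 * h2 * (h1 * (p \<bullet> g) - r * (norm p)\<^sup>2) \<le> 2 * h2 * (p \<bullet> (x - zs))"
    using h by (intro mult_left_mono) auto
  moreover have "2 * h2 * (h1 * (p \<bullet> g) - r * (norm p)\<^sup>2) = h1 * h2 * (2 * (p \<bullet> g)) - 2 * h2 * r * (norm p)\<^sup>2"
    by (simp add: algebra_simps)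
  moreover have "h1 * h2 * ((norm p)\<^sup>2 - 3 * (norm e1)\<^sup>2 + 2 * ((m - q) \<bullet> e1)) \<le> h1 * h2 * (2 * (p \<bullet> g))"
  proof (rule mult_left_mono)
    \<comment> \<open>Polarisation of \<open>p \<bullet> g\<close> with \<open>g = q + e1\<close>,
      where \<open>p - q\<close> in the mixed term is split at \<open>m\<close>. The term with
      \<open>m - q\<close> is the centred one.\<close>
    have pg: "2 * (p \<bullet> g) = (norm p)\<^sup>2 + (norm g)\<^sup>2 - (norm (p - q))\<^sup>2 + 2 * ((p - m) \<bullet> e1)
        + 2 * ((m - q) \<bullet> e1) - (norm e1)\<^sup>2"
      unfolding g_def q_def[symmetric] power2_norm_eq_inner
      by (simp add: inner_diff_left inner_diff_right inner_add_left inner_add_right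
        inner_commute algebra_simps)
    \<comment> \<open>Here \<open>L * h1 \<le> 1\<close> lets \<open>(norm g)\<^sup>2\<close>
      compensate \<open>(norm (p - q))\<^sup>2\<close>. The same condition bounds the term with
      \<open>p - m\<close> by \<open>2 * (norm e1)\<^sup>2\<close>, which with the explicit
      \<open>(norm e1)\<^sup>2\<close> makes the factor 3.\<close>
    have "norm (p - q) \<le> L * norm (xh - x)" unfolding p_def q_def by (rule lip)
    also have "\<dots> = (L * h1) * norm g" unfolding xh g_def[symmetric] using h by simp
    also have "\<dots> \<le> 1 * norm g" using h by (intro mult_right_mono) auto
    finally have 1: "(norm (p - q))\<^sup>2 \<le> (norm g)\<^sup>2" by (intro power_mono) auto
    have "norm (p - m) \<le> L * norm (xh - (x - h1 *\<^sub>R q))" unfolding p_def m_def q_def by (rule lip)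
    also have "xh - (x - h1 *\<^sub>R q) = - (h1 *\<^sub>R e1)" by (simp add: xh q_def scaleR_add_right)
    also have "L * norm (- (h1 *\<^sub>R e1)) = (L * h1) * norm e1" using h by simp
    also have "\<dots> \<le> 1 * norm e1" using h by (intro mult_right_mono) auto
    finally have "norm (p - m) * norm e1 \<le> (norm e1)\<^sup>2" by (simp add: power2_eq_square mult_right_mono)
    then have 2: "- ((p - m) \<bullet> e1) \<le> (norm e1)\<^sup>2"
      using Cauchy_Schwarz_ineq2[of "p - m" e1] by linarith
    show "(norm p)\<^sup>2 - 3 * (norm e1)\<^sup>2 + 2 * ((m - q) \<bullet> e1) \<le> 2 * (p \<bullet> g)"
      using pg 1 2 by linarith
  qed (use h in simp)
  ultimately show ?thesis
    unfolding x'_eq p_def[symmetric] q_def[symmetric] m_def[unfolded q_def[symmetric], symmetric]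
    by (simp add: algebra_simps)
qed

context stochastic_oracle
begin

context
  fixes L h1 h2 r :: real and zs :: 'x
  assumes lip: "\<And>v w. norm (F v - F w) \<le> L * norm (v - w)"
    and h: "0 \<le> L" "0 \<le> h1" "0 \<le> h2" "L * h1 \<le> 1"
    and minty: "\<And>v. - r * (norm (F v))\<^sup>2 \<le> F v \<bullet> (v - zs)"
begin

text \<open>The expectation of the pointwise inequality. Both inner products with the noise have
  mean zero: \<open>Y1\<close> is determined by \<open>X\<close>, hence by the samples in
  \<open>J\<close>, and \<open>Y2\<close> by \<open>X\<close> and \<open>Xh\<close>, hence by those
  in \<open>J \<union> A\<close>, while \<open>A\<close> and \<open>B\<close> are fresh for the
  respective past.\<close>

lemma extragradient_step:
  assumes J: "J \<subseteq> I" and X: "X \<in> borel_measurable (past J)" "square_integrable X"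
    and A: "A \<subseteq> I - J" "finite A" "A \<noteq> {}" and B: "B \<subseteq> I - (J \<union> A)" "finite B" "B \<noteq> {}"
    and Xh: "\<And>w. w \<in> space M \<Longrightarrow> Xh w = X w - h1 *\<^sub>R (1 / real (card A)) *\<^sub>R (\<Sum>i\<in>A. G (X w) (V i w))"
    and X': "\<And>w. w \<in> space M \<Longrightarrow> X' w = X w - h2 *\<^sub>R (1 / real (card B)) *\<^sub>R (\<Sum>i\<in>B. G (Xh w) (V i w))"
  shows "X' \<in> borel_measurable (past (J \<union> A \<union> B))" and "square_integrable X'"
    and "expectation (\<lambda>w. (norm (X' w - zs))\<^sup>2)
        + (h1 * h2 - h2\<^sup>2 - 2 * h2 * r) * expectation (\<lambda>w. (norm (F (Xh w)))\<^sup>2)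
      \<le> expectation (\<lambda>w. (norm (X w - zs))\<^sup>2)
        + 3 * h1 * h2 * (s / real (card A)) + h2\<^sup>2 * (s / real (card B))"
proof -
  have JA: "J \<union> A \<subseteq> I" using J A by auto
  have VA [measurable]: "V i \<in> borel_measurable (past (J \<union> A))" if "i \<in> A" for i
    using that by (intro measurable_past_sample) auto
  have VB [measurable]: "V i \<in> borel_measurable (past (J \<union> A \<union> B))" if "i \<in> B" for i
    using that by (intro measurable_past_sample) auto
  have X_JA [measurable]: "X \<in> borel_measurable (past (J \<union> A))"
    and X_JAB [measurable]: "X \<in> borel_measurable (past (J \<union> A \<union> B))"
    by (rule measurable_past_mono[OF _ X(1)]; auto)+
  have Xh_JA [measurable]: "Xh \<in> borel_measurable (past (J \<union> A))"
    by (subst measurable_cong[OF Xh]) (simp, measurable)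
  have Xh_JAB [measurable]: "Xh \<in> borel_measurable (past (J \<union> A \<union> B))"
    by (rule measurable_past_mono[OF _ Xh_JA]) auto
  show "X' \<in> borel_measurable (past (J \<union> A \<union> B))"
    by (subst measurable_cong[OF X']) (simp, measurable)
  have [measurable]: "X \<in> borel_measurable M" "Xh \<in> borel_measurable M"
    using measurable_pastD[OF J X(1)] measurable_pastD[OF JA Xh_JA] by auto
  define e1 e2 where "e1 = batch_noise X A" and "e2 = batch_noise Xh B"
  define Y1 Y2 where "Y1 w = F (X w - h1 *\<^sub>R F (X w)) - F (X w)"
    and "Y2 w = X w - zs - h2 *\<^sub>R F (Xh w)" for w
  have const: "square_integrable (\<lambda>_. zs)" by (simp add: square_integrable_def)
  have si: "square_integrable e1" "square_integrable e2" "square_integrable Y1" "square_integrable Y2"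
    "square_integrable (\<lambda>w. F (Xh w))" "square_integrable (\<lambda>w. X w - zs)"
    unfolding e1_def e2_def Y1_def Y2_def using A B
    by (auto intro!: square_integrable_batch_noise square_integrable_diff square_integrable_F
        square_integrable_scaleR X const)
  have Xh_eq: "Xh w = X w - h1 *\<^sub>R (F (X w) + e1 w)" if "w \<in> space M" for w
    using Xh[OF that] by (simp only: e1_def batch_average[OF A(2,3)])
  have X'_eq: "X' w = X w - h2 *\<^sub>R (F (Xh w) + e2 w)" if "w \<in> space M" for w
    using X'[OF that] by (simp only: e2_def batch_average[OF B(2,3)])
  have "square_integrable (\<lambda>w. X w - h2 *\<^sub>R (F (Xh w) + e2 w))"
    by (intro square_integrable_diff square_integrable_scaleR square_integrable_add X si)
  then show X'_si: "square_integrable X'"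
    using square_integrable_cong[of X' "\<lambda>w. X w - h2 *\<^sub>R (F (Xh w) + e2 w)"] X'_eq by simp
  have int: "integrable M (\<lambda>w. (norm (e1 w))\<^sup>2)" "integrable M (\<lambda>w. (norm (e2 w))\<^sup>2)"
    "integrable M (\<lambda>w. (norm (F (Xh w)))\<^sup>2)" "integrable M (\<lambda>w. (norm (X w - zs))\<^sup>2)"
    "integrable M (\<lambda>w. (norm (X' w - zs))\<^sup>2)" "integrable M (\<lambda>w. Y1 w \<bullet> e1 w)" "integrable M (\<lambda>w. Y2 w \<bullet> e2 w)"
    using si square_integrable_diff[OF X'_si const]
    by (auto simp: square_integrable_inner) (simp_all add: square_integrable_def)
  have "expectation (\<lambda>w. (norm (X' w - zs))\<^sup>2 + (h1 * h2 - h2\<^sup>2 - 2 * h2 * r) * (norm (F (Xh w)))\<^sup>2)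
    \<le> expectation (\<lambda>w. (norm (X w - zs))\<^sup>2 + 3 * h1 * h2 * (norm (e1 w))\<^sup>2 + h2\<^sup>2 * (norm (e2 w))\<^sup>2
      - 2 * h1 * h2 * (Y1 w \<bullet> e1 w) - 2 * h2 * (Y2 w \<bullet> e2 w))"
    unfolding Y1_def Y2_def
    by (rule integral_mono)
       (use int extragradient_pointwise[OF lip h minty Xh_eq X'_eq] in \<open>auto simp: Y1_def Y2_def\<close>)
  moreover have "expectation (\<lambda>w. Y1 w \<bullet> e1 w) = 0"
    unfolding e1_def using A si(3) J X(1)
    by (intro expectation_inner_batch_noise[of J]) (auto simp: Y1_def[abs_def])
  moreover have "expectation (\<lambda>w. Y2 w \<bullet> e2 w) = 0"
    unfolding e2_def using B si(4) JA Xh_JA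
    by (intro expectation_inner_batch_noise[of "J \<union> A"]) (auto simp: Y2_def[abs_def])
  moreover have "3 * h1 * h2 * expectation (\<lambda>w. (norm (e1 w))\<^sup>2) \<le> 3 * h1 * h2 * (s / real (card A))"
    unfolding e1_def using h by (intro mult_left_mono expectation_batch_noise_square[OF J X(1) A]) auto
  moreover have "h2\<^sup>2 * expectation (\<lambda>w. (norm (e2 w))\<^sup>2) \<le> h2\<^sup>2 * (s / real (card B))"
    unfolding e2_def by (intro mult_left_mono expectation_batch_noise_square[OF JA Xh_JA B]) auto
  ultimately show "expectation (\<lambda>w. (norm (X' w - zs))\<^sup>2)
        + (h1 * h2 - h2\<^sup>2 - 2 * h2 * r) * expectation (\<lambda>w. (norm (F (Xh w)))\<^sup>2)
      \<le> expectation (\<lambda>w. (norm (X w - zs))\<^sup>2)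
        + 3 * h1 * h2 * (s / real (card A)) + h2\<^sup>2 * (s / real (card B))"
    using int by simp
qed

lemma extragradient_sum:
  fixes A B J :: "nat \<Rightarrow> 'i set" and X Xh :: "nat \<Rightarrow> 'w \<Rightarrow> 'x"
  assumes J: "J 0 = {}" "\<And>k. J (Suc k) = J k \<union> A k \<union> B k"
    and A: "\<And>k. A k \<subseteq> I - J k" "\<And>k. finite (A k)" "\<And>k. A k \<noteq> {}"
    and B: "\<And>k. B k \<subseteq> I - (J k \<union> A k)" "\<And>k. finite (B k)" "\<And>k. B k \<noteq> {}"
    and X0: "\<And>w. w \<in> space M \<Longrightarrow> X 0 w = x0"
    and Xh: "\<And>k w. w \<in> space M \<Longrightarrow>
      Xh k w = X k w - h1 *\<^sub>R (1 / real (card (A k))) *\<^sub>R (\<Sum>i\<in>A k. G (X k w) (V i w))"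
    and X': "\<And>k w. w \<in> space M \<Longrightarrow>
      X (Suc k) w = X k w - h2 *\<^sub>R (1 / real (card (B k))) *\<^sub>R (\<Sum>i\<in>B k. G (Xh k w) (V i w))"
  shows "(h1 * h2 - h2\<^sup>2 - 2 * h2 * r) * (\<Sum>k<n. expectation (\<lambda>w. (norm (F (Xh k w)))\<^sup>2))
    \<le> (norm (x0 - zs))\<^sup>2 + s * (\<Sum>k<n. 3 * h1 * h2 / real (card (A k)) + h2\<^sup>2 / real (card (B k)))"
proof -
  have JI: "J k \<subseteq> I" for k
  proof (induction k)
    case (Suc k)
    then show ?case using A(1)[of k] B(1)[of k] by (auto simp: J(2))
  qed (simp add: J(1))
  have X: "X k \<in> borel_measurable (past (J k)) \<and> square_integrable (X k)" for k
  proof (induction k)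
    case 0
    have "X 0 \<in> borel_measurable (past (J 0))" by (subst measurable_cong[OF X0]) simp_all
    moreover have "square_integrable (X 0)"
      using square_integrable_cong[of "X 0" "\<lambda>_. x0"] X0 by (simp add: square_integrable_def)
    ultimately show ?case by simp
  next
    case (Suc k)
    then show ?case
      using extragradient_step(1,2)[OF JI _ _ A B Xh X', of k] by (auto simp: J)
  qed
  \<comment> \<open>The induction carries the expected squared distance of \<open>X n\<close>, which
    telescopes; being nonnegative, it is dropped at the end.\<close>
  have "expectation (\<lambda>w. (norm (X n w - zs))\<^sup>2)
        + (h1 * h2 - h2\<^sup>2 - 2 * h2 * r) * (\<Sum>k<n. expectation (\<lambda>w. (norm (F (Xh k w)))\<^sup>2))
      \<le> (norm (x0 - zs))\<^sup>2 + s * (\<Sum>k<n. 3 * h1 * h2 / real (card (A k)) + h2\<^sup>2 / real (card (B k)))"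
  proof (induction n)
    case 0
    have "expectation (\<lambda>w. (norm (X 0 w - zs))\<^sup>2) = expectation (\<lambda>w. (norm (x0 - zs))\<^sup>2)"
      by (rule Bochner_Integration.integral_cong) (auto simp: X0)
    then show ?case by (simp add: prob_space)
  next
    case (Suc n)
    then show ?case
      using extragradient_step(3)[OF JI X[THEN conjunct1] X[THEN conjunct2] A B Xh X', of n]
      by (simp add: algebra_simps)
  qed
  moreover have "0 \<le> expectation (\<lambda>w. (norm (X n w - zs))\<^sup>2)" by simp
  ultimately show ?thesis by linarith
qed

end
end

section \<open>The convergence bound\<close>

text \<open>The chain rule along the embeddings of the two factors. \<open>F_smooth\<close> is built
  from partial gradients, whereas the Lipschitz hypothesis concerns the full gradient.\<close>

lemma GDERIV_partial:
  fixes g :: "'a::real_inner \<times> 'b::real_inner \<Rightarrow> real"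
  assumes "GDERIV g z :> D"
  shows "GDERIV (\<lambda>x. g (x, snd z)) (fst z) :> fst D" and "GDERIV (\<lambda>y. g (fst z, y)) (snd z) :> snd D"
proof -
  have d: "(g has_derivative (\<lambda>h. h \<bullet> D)) (at (fst z, snd z))"
    using assms by (simp add: gderiv_def)
  have "((\<lambda>x. (x, snd z)) has_derivative (\<lambda>h. (h, 0))) (at (fst z))"
    "((\<lambda>y. (fst z, y)) has_derivative (\<lambda>h. (0, h))) (at (snd z))"
    by (auto intro!: derivative_eq_intros)
  from has_derivative_compose[OF this(1) d] has_derivative_compose[OF this(2) d]
  show "GDERIV (\<lambda>x. g (x, snd z)) (fst z) :> fst D" and "GDERIV (\<lambda>y. g (fst z, y)) (snd z) :> snd D"
    by (simp_all add: gderiv_def inner_prod_def)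
qed

text \<open>\<open>S\<close>, \<open>Q\<close> and \<open>D\<close> stand for the sum of expected
  squared operator norms, the sum of reciprocal batch sizes and the initial squared distance. The
  descent inequality is multiplied by \<open>C\<close> and divided by \<open>P * n\<close>.\<close>

lemma step_size_arithmetic:
  fixes L1 lmin lmax \<kappa> \<rho> h1 h2 S Q D \<sigma> :: real
  assumes lm: "0 < lmin" "lmin \<le> lmax" and \<kappa>: "\<kappa> = lmax / lmin" and L1: "0 < L1" and \<rho>: "0 \<le> \<rho>"
    and h: "0 < h1" "0 < h2" "h1 \<le> 1 / (L1 * lmax * \<kappa>)" "sqrt (\<rho> / (L1 * lmax * lmin * \<kappa>)) < h2" "h2 \<le> h1 / 2"
    and nonneg: "0 \<le> S" "0 \<le> Q" "0 \<le> D" and n: "0 < (n::real)"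
    and descent: "(h1 * h2 - h2\<^sup>2 - h2 * \<rho> / lmin) * S \<le> D + lmax * \<sigma>\<^sup>2 * ((3 * h1 * h2 + h2\<^sup>2) * Q)"
  shows "1 / n * S \<le> 2 * L1 * lmax * lmin * \<kappa> * D / ((L1 * lmax * lmin * \<kappa> * h2\<^sup>2 - \<rho>) * n)
    + 3 * lmin * \<sigma>\<^sup>2 / (L1 * \<kappa> * (L1 * lmax * lmin * \<kappa> * h2\<^sup>2 - \<rho>)) * (1 / n * Q)"
proof -
  define C where "C = L1 * lmax * lmin * \<kappa>"
  define P where "P = C * h2\<^sup>2 - \<rho>"
  have lmax: "0 < lmax" and \<kappa>1: "1 \<le> \<kappa>" using lm by (auto simp: \<kappa>)
  have C: "0 < C" using lm lmax \<kappa>1 L1 by (simp add: C_def)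
  \<comment> \<open>The lower bound on \<open>h2\<close> is the positivity of the denominator
    \<open>P\<close>.\<close>
  have "\<rho> / C < h2\<^sup>2"
    using h(2,4) real_sqrt_less_iff[of "\<rho> / C" "h2\<^sup>2"] by (simp add: C_def)
  then have P: "0 < P" using C by (simp add: P_def field_simps)
  have h1b: "L1 * lmax * \<kappa> * h1 \<le> 1"
    using h(3) L1 lmax \<kappa>1 by (simp add: field_simps)
  \<comment> \<open>From \<open>h2 \<le> h1 / 2\<close> follows
    \<open>h1 * h2 - h2\<^sup>2 \<ge> h2\<^sup>2\<close>, and
    \<open>C * h2 / lmin = L1 * lmax * \<kappa> * h2\<close> is at most 1 by the bound on
    \<open>h1\<close>.\<close>
  have "P \<le> C * (h1 * h2 - h2\<^sup>2 - h2 * \<rho> / lmin)"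
  proof -
    have "C * (h2 * h2) \<le> C * (h2 * (h1 - h2))"
      using C h by (intro mult_left_mono) auto
    moreover have "C * (h2 * \<rho> / lmin) \<le> \<rho>"
    proof -
      have "L1 * lmax * \<kappa> * h2 \<le> L1 * lmax * \<kappa> * h1" using L1 lmax \<kappa>1 h by (intro mult_left_mono) auto
      then have "(L1 * lmax * \<kappa> * h2) * \<rho> \<le> 1 * \<rho>" using h1b \<rho> by (intro mult_right_mono) auto
      then show ?thesis using lm by (simp add: C_def mult_ac)
    qed
    ultimately show ?thesis by (simp add: P_def algebra_simps power2_eq_square)
  qed
  then have "P * S \<le> C * (h1 * h2 - h2\<^sup>2 - h2 * \<rho> / lmin) * S" using nonneg by (intro mult_right_mono)
  also have "\<dots> \<le> C * (D + lmax * \<sigma>\<^sup>2 * ((3 * h1 * h2 + h2\<^sup>2) * Q))"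
    using mult_left_mono[OF descent, of C] C by (simp add: mult.assoc)
  also have "\<dots> = C * D + (C * lmax * (3 * h1 * h2 + h2\<^sup>2)) * (\<sigma>\<^sup>2 * Q)" by (simp add: algebra_simps)
  also have "\<dots> \<le> 2 * C * D + (3 * lmin / (L1 * \<kappa>)) * (\<sigma>\<^sup>2 * Q)"
  proof (intro add_mono mult_right_mono)
    show "C \<le> 2 * C" using C by simp
    \<comment> \<open>The right side is \<open>7 / 4 * h1\<^sup>2\<close>. The weaker bound
      \<open>3 * h1\<^sup>2\<close> yields exactly the noise constant of the claim when
      \<open>h1\<close> is the largest admissible step.\<close>
    have "h2 * (3 * h1 + h2) \<le> h1 / 2 * (3 * h1 + h1 / 2)"
      using h by (intro mult_mono) auto
    also have "\<dots> \<le> 3 * (h1 * h1)" using h by (simp add: algebra_simps)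
    finally have "3 * h1 * h2 + h2\<^sup>2 \<le> 3 * (h1 * h1)" by (simp add: power2_eq_square algebra_simps)
    then have "C * lmax * (3 * h1 * h2 + h2\<^sup>2) \<le> C * lmax * (3 * (h1 * h1))"
      using C lmax by (intro mult_left_mono) auto
    also have "\<dots> = 3 * lmin / (L1 * \<kappa>) * ((L1 * lmax * \<kappa> * h1) * (L1 * lmax * \<kappa> * h1))"
      using L1 \<kappa>1 by (simp add: C_def)
    also have "\<dots> \<le> 3 * lmin / (L1 * \<kappa>) * (1 * 1)"
      using h1b L1 lmax \<kappa>1 h lm by (intro mult_left_mono mult_mono) auto
    finally show "C * lmax * (3 * h1 * h2 + h2\<^sup>2) \<le> 3 * lmin / (L1 * \<kappa>)" by simp
  qed (use nonneg in auto)
  finally have "P * S \<le> 2 * C * D + 3 * lmin / (L1 * \<kappa>) * (\<sigma>\<^sup>2 * Q)" .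
  then have "S \<le> (2 * C * D + 3 * lmin / (L1 * \<kappa>) * (\<sigma>\<^sup>2 * Q)) / P"
    using P by (simp add: field_simps)
  then have "1 / n * S \<le> 1 / n * ((2 * C * D + 3 * lmin / (L1 * \<kappa>) * (\<sigma>\<^sup>2 * Q)) / P)"
    using n by (intro mult_left_mono) auto
  also have "\<dots> = 2 * C * D / (P * n) + 3 * lmin * \<sigma>\<^sup>2 / (L1 * \<kappa> * P) * (1 / n * Q)"
    using n P L1 \<kappa>1 by (simp add: field_simps)
  finally show ?thesis by (simp add: C_def P_def mult.assoc)
qed

theorem theorem6:
  fixes B1 :: "real ^ 'n ^ 'n" and B2 :: "real ^ 'm ^ 'm"
    and f :: "(real ^ 'n) \<times> (real ^ 'm) \<Rightarrow> real"
    and L0 L1 \<mu> \<sigma> \<rho> h1 h2 :: real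
    and zstar z0 :: "(real ^ 'n) \<times> (real ^ 'm)"
    and t :: "nat \<Rightarrow> nat" and N :: nat
    and M :: "'w measure"
    and uh u :: "nat \<Rightarrow> nat \<Rightarrow> 'w \<Rightarrow> (real ^ 'n) \<times> (real ^ 'm)"
    and zh z :: "nat \<Rightarrow> 'w \<Rightarrow> (real ^ 'n) \<times> (real ^ 'm)"
  defines "F \<equiv> F_smooth B1 B2 \<mu> f"
    and "lmin \<equiv> lam_min B1 B2"
    and "lmax \<equiv> lam_max B1 B2"
    and "\<kappa> \<equiv> cond_num B1 B2"
  assumes "spd B1" and "spd B2"
    and "L0 > 0" and "\<And>v w. \<bar>f v - f w\<bar> \<le> L0 * Bnorm B1 B2 (v - w)"
    and "\<mu> > 0"
    and "L1 > 0"
    and "\<And>v w. Bnorm_dual B1 B2 (grad (smooth B1 B2 \<mu> f) v - grad (smooth B1 B2 \<mu> f) w)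
               \<le> L1 * Bnorm B1 B2 (v - w)"
    and "\<sigma> \<ge> 0"
    and "\<And>v. (\<integral>\<xi>. (Bnorm_dual B1 B2 (G_oracle B1 B2 \<mu> f v \<xi> - F v))\<^sup>2 \<partial>gauss B1 B2) \<le> \<sigma>\<^sup>2"
    and "0 \<le> \<rho>" and "\<rho> < 1 / (4 * L1 * \<kappa>\<^sup>2)"
    and "\<And>v. F v \<bullet> (v - zstar) + \<rho> / 2 * (Bnorm_dual B1 B2 (F v))\<^sup>2 \<ge> 0"
    and "\<And>k. t k \<ge> 1"
    and "h1 > 0" and "h2 > 0"
    and "h1 \<le> 1 / (L1 * lmax * \<kappa>)"
    and "sqrt (\<rho> / (L1 * lmax * lmin * \<kappa>)) < h2" and "h2 \<le> h1 / 2"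
    and "prob_space M"
    and "gauss_samples B1 B2 t M uh u"
    and "zo_eg_run B1 B2 \<mu> f h1 h2 t z0 M uh u zh z"
  shows "1 / (real N + 1) * (\<Sum>k=0..N. \<integral>w. (norm (F (zh k w)))\<^sup>2 \<partial>M)
    \<le> 2 * L1 * lmax * lmin * \<kappa> * (norm (z0 - zstar))\<^sup>2
        / ((L1 * lmax * lmin * \<kappa> * h2\<^sup>2 - \<rho>) * (real N + 1))
      + 3 * lmin * \<sigma>\<^sup>2 / (L1 * \<kappa> * (L1 * lmax * lmin * \<kappa> * h2\<^sup>2 - \<rho>))
        * (1 / (real N + 1) * (\<Sum>k=0..N. 1 / real (t k)))"
proof -
  have \<mu>: "0 < \<mu>" by fact
  interpret B: spd_pair B1 B2 by unfold_locales fact+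
  have lmin: "0 < lmin" and lmax: "0 < lmax" and lmm: "lmin \<le> lmax"
    using B.lam_min_pos B.lam_max_pos B.lam_min_le_lam_max by (simp_all add: lmin_def lmax_def)
  have \<kappa>: "\<kappa> = lmax / lmin" by (simp add: \<kappa>_def cond_num_def lmin_def lmax_def)
  let ?T = "block_diag B1 B2" and ?\<gamma> = "gauss B1 B2" and ?G = "G_oracle B1 B2 \<mu> f"
  \<comment> \<open>Both sample families become one independent family; the index
    \<open>False\<close> marks the extrapolation samples \<open>uh\<close>, \<open>True\<close> the
    update samples \<open>u\<close>.\<close>
  define V where "V = (\<lambda>(b, k, i). if b then u k i else uh k i)"
  define I where "I = (UNIV :: bool set) \<times> (SIGMA k:UNIV. {1..t k})"
  have indep: "prob_space.indep_vars M (\<lambda>_. borel) V I"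
    and law: "\<And>i. i \<in> I \<Longrightarrow> distr M borel (V i) = ?\<gamma>"
    using \<open>gauss_samples B1 B2 t M uh u\<close> by (auto simp: gauss_samples_def V_def I_def)
  interpret sampling M V I ?\<gamma>
    using \<open>prob_space M\<close> indep law by (simp add: sampling_def sampling_axioms_def)
  \<comment> \<open>Batch 0 is nonempty, so \<open>gauss\<close> is the law of an actual sample and
    therefore a probability measure.\<close>
  have i0: "(False, 0, 1) \<in> I" using \<open>\<And>k. t k \<ge> 1\<close> by (simp add: I_def)
  have gauss_prob: "prob_space ?\<gamma>"
    unfolding law[OF i0, symmetric] by (rule prob_space_distr[OF V_measurable[OF i0]])
  define c where "c = 1 / sqrt ((2 * pi) ^ (CARD('n) + CARD('m)) * (det (matrix_inv B1) * det (matrix_inv B2)))"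
  have gauss_eq: "?\<gamma> = density lborel (\<lambda>u. ennreal (c * exp (- (u \<bullet> ?T u) / 2)))"
    using spd_invertible[OF B.spd1] spd_invertible[OF B.spd2]
    by (simp add: gauss_def normal_block_def matrix_inv_matrix_inv c_def)
  interpret \<gamma>: gaussian_density ?T lmin c ?\<gamma>
    by (rule gaussian_density.intro)
       (use gauss_eq gauss_prob linear_block_diag B.block_diag_sym lmin B.lam_min_le in \<open>auto simp: lmin_def\<close>)
  define L where "L = L0 * sqrt lmax"
  have f_lip: "\<bar>f v - f w\<bar> \<le> L * norm (v - w)" for v w
    using \<open>\<bar>f v - f w\<bar> \<le> L0 * Bnorm B1 B2 (v - w)\<close> B.Bnorm_le[of "v - w"] \<open>L0 > 0\<close>
    by (smt (verit) L_def lmax_def mult.assoc mult_left_mono)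
  have "L-lipschitz_on UNIV f"
    using f_lip \<open>L0 > 0\<close> lmax by (intro lipschitz_onI) (auto simp: dist_norm L_def)
  then have f_cont: "continuous_on UNIV f" by (rule lipschitz_on_continuous_on)
  have [measurable]: "f \<in> borel_measurable borel" by (rule borel_measurable_continuous_onI[OF f_cont])

  \<comment> \<open>The sign change in the second block is a linear isometry that turns gradients
    into values of \<open>F\<close>, so Lipschitz bounds and means pass from \<open>D\<close> to
    \<open>F\<close>.\<close>
  define flip :: "(real ^ 'n) \<times> (real ^ 'm) \<Rightarrow> (real ^ 'n) \<times> (real ^ 'm)" where "flip p = (fst p, - snd p)" for p
  have flip: "bounded_linear flip"
    unfolding flip_def
    by (intro bounded_linear_Pair bounded_linear_fst bounded_linear_minus bounded_linear_snd)
  have norm_flip: "norm (flip p) = norm p" for p by (simp add: flip_def norm_prod_def)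
  have flip_diff: "flip p - flip q = flip (p - q)" for p q by (simp add: flip_def)
  define D where "D v = (\<integral>\<xi>. ((f (v + \<mu> *\<^sub>R \<xi>) - f v) / \<mu>) *\<^sub>R ?T \<xi> \<partial>?\<gamma>)" for v
  have deriv: "GDERIV (smooth B1 B2 \<mu> f) v :> D v" for v
    using \<gamma>.GDERIV_smoothing_Lipschitz[OF \<mu> f_lip, of v] unfolding D_def smooth_def[abs_def] .
  have grad: "grad (smooth B1 B2 \<mu> f) v = D v" for v by (rule grad_eqI[OF deriv])
  have F_eq: "F v = flip (D v)" for v
    using grad_eqI[OF GDERIV_partial(1)[OF deriv[of v]]] grad_eqI[OF GDERIV_partial(2)[OF deriv[of v]]]
    by (simp add: F_def F_smooth_def flip_def)
  have G_eq: "?G v \<xi> = flip (((f (v + \<mu> *\<^sub>R \<xi>) - f v) / \<mu>) *\<^sub>R ?T \<xi>)" for v \<xi>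
    by (simp add: G_oracle_def flip_def block_diag_def)
  define b where "b \<xi> = L * norm \<xi> * norm (?T \<xi>)" for \<xi>
  have b_bound: "norm (((f (v + \<mu> *\<^sub>R \<xi>) - f v) / \<mu>) *\<^sub>R ?T \<xi>) \<le> b \<xi>" for v \<xi>
  proof -
    have "\<bar>(f (v + \<mu> *\<^sub>R \<xi>) - f v) / \<mu>\<bar> \<le> L * norm \<xi>"
      using f_lip[of "v + \<mu> *\<^sub>R \<xi>" v] \<mu> by (simp add: field_simps)
    from mult_right_mono[OF this, of "norm (?T \<xi>)"] show ?thesis
      by (simp only: b_def norm_scaleR real_norm_def norm_ge_zero simp_thms)
  qed
  have b_meas [measurable]: "b \<in> borel_measurable borel" unfolding b_def by measurable
  have b_sq: "integrable ?\<gamma> (\<lambda>\<xi>. (b \<xi>)\<^sup>2)" unfolding b_def by (rule \<gamma>.oracle_bound_square_integrable)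
  have G_bound: "norm (?G v \<xi>) \<le> b \<xi>" for v \<xi> using b_bound by (simp add: G_eq norm_flip)
  have [measurable]: "flip \<in> borel_measurable borel"
    by (intro borel_measurable_continuous_onI linear_continuous_on flip)
  have G_meas: "case_prod ?G \<in> borel_measurable (borel \<Otimes>\<^sub>M borel)"
    unfolding G_eq[abs_def] by measurable
  have G_meas_v [measurable]: "?G v \<in> borel_measurable borel" for v
    unfolding G_eq[abs_def] by measurable
  have F_lip: "norm (F v - F w) \<le> (lmax * L1) * norm (v - w)" for v w
  proof -
    \<comment> \<open>A factor \<open>sqrt lmax\<close> arises on each side: from the dual norm on
      values and from the primal norm on arguments.\<close>
    have "norm (F v - F w) \<le> sqrt lmax * Bnorm_dual B1 B2 (D v - D w)"
      using B.norm_le_Bnorm_dual[of "D v - D w"] by (simp add: F_eq flip_diff norm_flip lmax_def)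
    also have "\<dots> \<le> sqrt lmax * (L1 * Bnorm B1 B2 (v - w))"
      using \<open>Bnorm_dual B1 B2 (grad (smooth B1 B2 \<mu> f) v - grad (smooth B1 B2 \<mu> f) w)
        \<le> L1 * Bnorm B1 B2 (v - w)\<close> lmax by (intro mult_left_mono) (auto simp: grad)
    also have "\<dots> \<le> sqrt lmax * (L1 * (sqrt lmax * norm (v - w)))"
      using B.Bnorm_le[of "v - w"] lmax \<open>L1 > 0\<close> by (intro mult_left_mono) (auto simp: lmax_def)
    also have "\<dots> = (sqrt lmax * sqrt lmax) * L1 * norm (v - w)" by (simp only: mult_ac)
    finally show ?thesis using lmax by simp
  qed
  have "(lmax * L1)-lipschitz_on UNIV F"
    using F_lip \<open>L1 > 0\<close> lmax by (intro lipschitz_onI) (auto simp: dist_norm)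
  then have F_meas: "F \<in> borel_measurable borel"
    by (intro borel_measurable_continuous_onI lipschitz_on_continuous_on)
  have b_int: "integrable ?\<gamma> b"
    by (rule \<gamma>.square_integrable_imp_integrable[OF _ b_sq]) measurable
  have G_mean: "(\<integral>\<xi>. ?G v \<xi> \<partial>?\<gamma>) = F v" for v
    unfolding F_eq G_eq D_def
  proof (rule integral_bounded_linear[OF flip])
    show "integrable ?\<gamma> (\<lambda>\<xi>. ((f (v + \<mu> *\<^sub>R \<xi>) - f v) / \<mu>) *\<^sub>R ?T \<xi>)"
      by (rule Bochner_Integration.integrable_bound[OF b_int])
         (measurable, intro AE_I2, rule order_trans[OF b_bound], simp)
  qed
  have G_var: "(\<integral>\<xi>. (norm (?G v \<xi> - F v))\<^sup>2 \<partial>?\<gamma>) \<le> lmax * \<sigma>\<^sup>2" for v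
  proof -
    have "integrable ?\<gamma> (\<lambda>\<xi>. 2 * (b \<xi>)\<^sup>2 + 2 * (norm (F v))\<^sup>2)" using b_sq by simp
    \<comment> \<open>Integrability is established separately, since a bound on a Bochner integral
      does not imply it: the integral of a non-integrable function is 0 by convention.\<close>
    then have i1: "integrable ?\<gamma> (\<lambda>\<xi>. (norm (?G v \<xi> - F v))\<^sup>2)"
    proof (rule Bochner_Integration.integrable_bound)
      have "(norm (?G v \<xi> - F v))\<^sup>2 \<le> 2 * (b \<xi>)\<^sup>2 + 2 * (norm (F v))\<^sup>2" for \<xi>
      proof -
        have "norm (?G v \<xi> - F v) \<le> b \<xi> + norm (F v)"
          using norm_triangle_ineq4[of "?G v \<xi>" "F v"] G_bound[of v \<xi>] by linarith
        then have "(norm (?G v \<xi> - F v))\<^sup>2 \<le> (b \<xi> + norm (F v))\<^sup>2" by (rule power_mono) simp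
        also have "\<dots> \<le> 2 * (b \<xi>)\<^sup>2 + 2 * (norm (F v))\<^sup>2"
          using sum_squares_bound[of "b \<xi>" "norm (F v)"] by (simp add: power2_sum)
        finally show ?thesis .
      qed
      then show "AE \<xi> in ?\<gamma>. norm ((norm (?G v \<xi> - F v))\<^sup>2) \<le> norm (2 * (b \<xi>)\<^sup>2 + 2 * (norm (F v))\<^sup>2)"
        by (auto intro: order_trans[OF _ abs_ge_self])
    qed measurable
    have i2: "integrable ?\<gamma> (\<lambda>\<xi>. (Bnorm_dual B1 B2 (?G v \<xi> - F v))\<^sup>2)"
    proof (rule Bochner_Integration.integrable_bound[OF integrable_mult_right[OF i1, of "1 / lmin"]])
      show "AE \<xi> in ?\<gamma>. norm ((Bnorm_dual B1 B2 (?G v \<xi> - F v))\<^sup>2) \<le> norm (1 / lmin * (norm (?G v \<xi> - F v))\<^sup>2)"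
        using B.Bnorm_dual_sq_bounds(3) lmin by (auto simp: lmin_def field_simps)
    qed (unfold Bnorm_dual_def, measurable)
    have "(\<integral>\<xi>. (norm (?G v \<xi> - F v))\<^sup>2 \<partial>?\<gamma>) \<le> (\<integral>\<xi>. lmax * (Bnorm_dual B1 B2 (?G v \<xi> - F v))\<^sup>2 \<partial>?\<gamma>)"
      using i1 i2 B.Bnorm_dual_sq_bounds(2) by (intro integral_mono) (auto simp: lmax_def)
    also have "\<dots> = lmax * (\<integral>\<xi>. (Bnorm_dual B1 B2 (?G v \<xi> - F v))\<^sup>2 \<partial>?\<gamma>)" by simp
    also have "\<dots> \<le> lmax * \<sigma>\<^sup>2"
      using lmax \<open>(\<integral>\<xi>. (Bnorm_dual B1 B2 (?G v \<xi> - F v))\<^sup>2 \<partial>?\<gamma>) \<le> \<sigma>\<^sup>2\<close> by (intro mult_left_mono) auto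
    finally show ?thesis .
  qed
  interpret stochastic_oracle M V I ?\<gamma> ?G F b "lmax * \<sigma>\<^sup>2"
    by unfold_locales (use gauss_prob G_meas F_meas G_bound b_meas b_sq G_mean G_var in auto)

  \<comment> \<open>The inequality
    \<open>lmin * (Bnorm_dual B1 B2 v)\<^sup>2 \<le> (norm v)\<^sup>2\<close> converts the Minty
    term to the Euclidean norm; then \<open>2 * h2 * r = h2 * \<rho> / lmin\<close>.\<close>
  define r where "r = \<rho> / (2 * lmin)"
  have minty: "- r * (norm (F v))\<^sup>2 \<le> F v \<bullet> (v - zstar)" for v
  proof -
    have "\<rho> / 2 * (Bnorm_dual B1 B2 (F v))\<^sup>2 \<le> \<rho> / 2 * ((norm (F v))\<^sup>2 / lmin)"
      using B.Bnorm_dual_sq_bounds(3)[of "F v"] lmin \<open>0 \<le> \<rho>\<close>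
      by (intro mult_left_mono) (auto simp: lmin_def field_simps)
    then show ?thesis
      using \<open>F v \<bullet> (v - zstar) + \<rho> / 2 * (Bnorm_dual B1 B2 (F v))\<^sup>2 \<ge> 0\<close> by (simp add: r_def)
  qed
  have Lh: "lmax * L1 * h1 \<le> 1"
  proof -
    have "1 \<le> \<kappa>" using lmin lmm by (simp add: \<kappa>)
    have "lmax * L1 * h1 * 1 \<le> lmax * L1 * h1 * \<kappa>"
      using \<open>1 \<le> \<kappa>\<close> lmax \<open>L1 > 0\<close> \<open>h1 > 0\<close> by (intro mult_left_mono) auto
    also have "\<dots> \<le> 1"
      using \<open>h1 \<le> 1 / (L1 * lmax * \<kappa>)\<close> lmax \<open>L1 > 0\<close> \<open>1 \<le> \<kappa>\<close> by (simp add: field_simps)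
    finally show ?thesis by simp
  qed
  \<comment> \<open>\<open>A False k\<close> and \<open>A True k\<close> index the two batches of
    iteration \<open>k\<close>, and \<open>J k\<close> all samples of the iterations before
    \<open>k\<close>.\<close>
  define A where "A c k = (\<lambda>i. (c, k, i)) ` {1..t k}" for c :: bool and k
  define J where "J k = (UNIV :: bool set) \<times> (SIGMA j:{..<k}. {1..t j})" for k
  have card_A: "card (A c k) = t k" for c k
    by (simp add: A_def card_image inj_on_def)
  have sum_A: "(\<Sum>i\<in>A c k. g i) = (\<Sum>i=1..t k. g (c, k, i))" for c k and g :: "_ \<Rightarrow> (real ^ 'n) \<times> (real ^ 'm)"
    by (simp add: A_def sum.reindex inj_on_def)
  have A_ne: "A c k \<noteq> {}" and A_fin: "finite (A c k)" for c k
    using \<open>t k \<ge> 1\<close> by (auto simp: A_def)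
  have run: "z 0 w = z0"
    "zh k w = z k w - h1 *\<^sub>R (1 / real (t k)) *\<^sub>R (\<Sum>i=1..t k. ?G (z k w) (uh k i w))"
    "z (Suc k) w = z k w - h2 *\<^sub>R (1 / real (t k)) *\<^sub>R (\<Sum>i=1..t k. ?G (zh k w) (u k i w))"
    if "w \<in> space M" for w k
    using \<open>zo_eg_run B1 B2 \<mu> f h1 h2 t z0 M uh u zh z\<close> that by (simp_all add: zo_eg_run_def)
  \<comment> \<open>Iterations 0 to \<open>N\<close> make \<open>Suc N\<close> steps.\<close>
  have "(h1 * h2 - h2\<^sup>2 - 2 * h2 * r) * (\<Sum>k<Suc N. expectation (\<lambda>w. (norm (F (zh k w)))\<^sup>2))
    \<le> (norm (z0 - zstar))\<^sup>2 + lmax * \<sigma>\<^sup>2 *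
      (\<Sum>k<Suc N. 3 * h1 * h2 / real (card (A False k)) + h2\<^sup>2 / real (card (A True k)))"
  proof (rule extragradient_sum[where A="A False" and B="A True" and J=J and X=z and L="lmax * L1"])
    show "J (Suc k) = J k \<union> A False k \<union> A True k" for k
      by (auto simp: J_def A_def less_Suc_eq image_iff)
    show "zh k w = z k w - h1 *\<^sub>R (1 / real (card (A False k))) *\<^sub>R (\<Sum>i\<in>A False k. ?G (z k w) (V i w))"
      if "w \<in> space M" for k w
      unfolding card_A sum_A using run(2)[OF that] by (simp add: V_def)
    show "z (Suc k) w = z k w - h2 *\<^sub>R (1 / real (card (A True k))) *\<^sub>R (\<Sum>i\<in>A True k. ?G (zh k w) (V i w))"
      if "w \<in> space M" for k w
      unfolding card_A sum_A using run(3)[OF that] by (simp add: V_def)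
  qed (use F_lip minty Lh lmax \<open>L1 > 0\<close> \<open>h1 > 0\<close> \<open>h2 > 0\<close> A_ne A_fin run(1) in
      \<open>auto simp: J_def A_def I_def\<close>)
  then have descent: "(h1 * h2 - h2\<^sup>2 - h2 * \<rho> / lmin) * (\<Sum>k=0..N. expectation (\<lambda>w. (norm (F (zh k w)))\<^sup>2))
    \<le> (norm (z0 - zstar))\<^sup>2 + lmax * \<sigma>\<^sup>2 * ((3 * h1 * h2 + h2\<^sup>2) * (\<Sum>k=0..N. 1 / real (t k)))"
    using lmin unfolding card_A lessThan_Suc_atMost atMost_atLeast0
    by (simp add: r_def add_divide_distrib[symmetric] sum_distrib_left)
  show ?thesis
    by (rule step_size_arithmetic[OF lmin lmm \<kappa> \<open>L1 > 0\<close> \<open>0 \<le> \<rho>\<close> \<open>h1 > 0\<close> \<open>h2 > 0\<close>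
          \<open>h1 \<le> 1 / (L1 * lmax * \<kappa>)\<close> \<open>sqrt (\<rho> / (L1 * lmax * lmin * \<kappa>)) < h2\<close> \<open>h2 \<le> h1 / 2\<close>
          _ _ _ _ descent])
       (auto intro!: sum_nonneg)
qed

end
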